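(* Let $\mathbb{K}$ be a quadratically closed field. Then $\mathrm{NT}_n(\mathbb{K})$ is, up to similarity, the sole maximal linear subspace of $\mathrm{M}_n(\mathbb{K})$ with a trivial spectrum; that is, $\mathrm{NT}_n(\mathbb{K})$ is such a subspace and every maximal linear subspace $V$ of $\mathrm{M}_n(\mathbb{K})$ with a trivial spectrum satisfies $V=R\,\mathrm{NT}_n(\mathbb{K})\,R^{-1}$ for some $R\in\mathrm{GL}_n(\mathbb{K})$.
   Context: A field $\mathbb{K}$ is quadratically closed if every polynomial of degree $2$ over $\mathbb{K}$ has a root in $\mathbb{K}$ (equivalently, $\mathbb{K}$ has no field extension of degree $2$). $\mathrm{M}_n(\mathbb{K})$ is the algebra of $n\times n$ matrices over $\mathbb{K}$ and $\mathrm{NT}_n(\mathbb{K})$ is its subspace of strictly upper triangular matrices. A linear subspace $H$ of $\mathrm{M}_n(\mathbb{K})$ has a trivial spectrum if no matrix $M\in H$ has a non-zero vector $X\in\mathbb{K}^n$ with $MX=X$. Such a subspace is called maximal if its dimension is $\binom{n}{2}$. *)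

theory Defs
  imports "Jordan_Normal_Form.VS_Connect" "HOL-Computational_Algebra.Polynomial"
begin

definition quadratically_closed :: "'a :: field itself \<Rightarrow> bool" where
  "quadratically_closed ty \<longleftrightarrow> (\<forall>p :: 'a poly. degree p = 2 \<longrightarrow> (\<exists>x. poly p x = 0))"

definition strict_upper_triangular_mats :: "nat \<Rightarrow> 'a :: zero mat set" where
  "strict_upper_triangular_mats n =
     {A \<in> carrier_mat n n. \<forall>i<n. \<forall>j<n. j \<le> i \<longrightarrow> A $$ (i, j) = 0}"

definition trivial_spectrum :: "nat \<Rightarrow> 'a :: field mat set \<Rightarrow> bool" where
  "trivial_spectrum n H \<longleftrightarrow>
     (\<forall>M \<in> H. \<not> (\<exists>X \<in> carrier_vec n. X \<noteq> 0\<^sub>v n \<and> M *\<^sub>v X = X))"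

text \<open>Maximality refers to the dimension \<open>n choose 2\<close>, not to maximality with respect to inclusion.\<close>

definition maximal_trivial_spectrum_subspace :: "nat \<Rightarrow> 'a :: field mat set \<Rightarrow> bool" where
  "maximal_trivial_spectrum_subspace n V \<longleftrightarrow>
     VectorSpace.subspace class_ring V (module_mat TYPE('a) n n) \<and>
     trivial_spectrum n V \<and>
     vectorspace.dim class_ring (module_mat TYPE('a) n n\<lparr>carrier := V\<rparr>) = n choose 2"

end

theory Submission
  imports Defs "Jordan_Normal_Form.Gauss_Jordan_Elimination"
begin

text \<open>Let \<open>V\<close> be maximal. Some basis vector \<open>e\<^sub>n\<close> spans the image of no matrix of \<open>V\<close>; then the
  matrices of \<open>V\<close> killing \<open>e\<^sub>n\<close> induce on the quotient by \<open>e\<^sub>n\<close> a maximal space of size \<open>n - 1\<close>, which by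
  induction is \<open>NT\<close> in a suitable basis. So \<open>V\<close> contains, for each \<open>x\<close> in the span of \<open>e\<^sub>1, ..., e\<^sub>n\<^sub>-\<^sub>2\<close>, a matrix
  of rank at most two sending \<open>e\<^sub>n\<^sub>-\<^sub>1\<close> to \<open>x\<close> modulo \<open>e\<^sub>n\<close>. Over a quadratically closed field the determinant of
  \<open>1 - M - t A\<close> with \<open>A\<close> of rank two is a polynomial of degree at most two in \<open>t\<close> without roots, hence
  constant. This forces the above matrices to have rank one and common kernel, and then their
  images span a subspace of dimension \<open>n - 2\<close> that is invariant under \<open>V\<close>. By the dimension bound
  \<open>n choose 2\<close> for spaces with trivial spectrum, the two diagonal blocks of \<open>V\<close> are again maximal, and
  induction applies to them.\<close>

section \<open>Dimensions of spaces of matrices\<close>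

text \<open>The field hypothesis cannot be dropped: the real skew-symmetric matrices form a space of
  dimension n choose 2 with a trivial spectrum, and their non-zero members are not nilpotent. Roots
  of quadratics only control perturbations of rank at most two, and this dictates which matrices are
  usable: a member of V that kills e_n and whose block on the first n - 1 coordinates has rank one
  has rank at most two, since its last row adds at most one. Hence the role of the lifts of the
  matrix units in the last column of NT_(n-1). They pin down only n - 2 directions, so the invariant
  subspace has codimension two and n = 2 is a base case of its own. Coefficients of resolvents in a
  parameter s are extracted without power series: multiplying by the determinant makes a resolvent
  polynomial in s, and identities can be divided by s because the field is infinite.\<close>

definition mat_subspace :: "nat \<Rightarrow> nat \<Rightarrow> 'a :: field mat set \<Rightarrow> bool" where
  "mat_subspace r c V \<longleftrightarrow> V \<subseteq> carrier_mat r c \<and> 0\<^sub>m r c \<in> V \<and>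
     (\<forall>A\<in>V. \<forall>B\<in>V. A + B \<in> V) \<and> (\<forall>a. \<forall>A\<in>V. a \<cdot>\<^sub>m A \<in> V)"

definition mat_dim :: "nat \<Rightarrow> nat \<Rightarrow> 'a :: field mat set \<Rightarrow> nat" where
  "mat_dim r c V = vectorspace.dim class_ring (module_mat TYPE('a) r c\<lparr>carrier := V\<rparr>)"

lemma subspace_iff_mat_subspace:
  fixes V :: "'a :: field mat set"
  shows "VectorSpace.subspace class_ring V (module_mat TYPE('a) r c) \<longleftrightarrow> mat_subspace r c V"
proof -
  interpret vectorspace class_ring "module_mat TYPE('a) r c" by (rule matrix_vs)
  have "submodule class_ring V (module_mat TYPE('a) r c) \<longleftrightarrow> mat_subspace r c V"
    unfolding submodule_def mat_subspace_def using module_axioms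
    by (auto simp: module_mat_simps)
  then show ?thesis
    unfolding VectorSpace.subspace_def using matrix_vs by auto
qed

text \<open>Reading a vector of length \<open>r * c\<close> row by row is a linear bijection onto
  the matrices, so finite dimension and its value carry over from vectors.\<close>

lemma matrix_vs_fin_dim:
  "vectorspace.fin_dim class_ring (module_mat TYPE('a :: field) r c)"
  "vectorspace.dim class_ring (module_mat TYPE('a :: field) r c) = r * c"
proof -
  let ?M = "module_mat TYPE('a) r c"
  let ?V = "module_vec TYPE('a) (r * c)"
  define T :: "'a vec \<Rightarrow> 'a mat" where "T v = mat r c (\<lambda>(i, j). v $ (i * c + j))" for v
  have ix: "i * c + j < r * c" if "i < r" "j < c" for i j
  proof -
    have "i * c + j < Suc i * c" using that by simp
    also have "\<dots> \<le> r * c" using that by (intro mult_le_mono1) auto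
    finally show ?thesis .
  qed
  interpret W: vectorspace class_ring ?M by (rule matrix_vs)
  interpret vec_space "TYPE('a)" "r * c" .
  have hom: "T \<in> LinearCombinations.module_hom class_ring ?V ?M"
    unfolding LinearCombinations.module_hom_def using ix
    by (auto simp: module_mat_simps module_vec_simps T_def)
  have lm: "linear_map class_ring ?V ?M T"
    unfolding linear_map_def mod_hom_def mod_hom_axioms_def
    using hom W.module_axioms vectorspace_axioms W.vectorspace_axioms vectorspace.axioms(1)
    by blast
  have inj: "inj_on T (carrier ?V)"
  proof (rule inj_onI)
    fix v w assume v: "v \<in> carrier ?V" and w: "w \<in> carrier ?V" and eq: "T v = T w"
    show "v = w"
    proof (rule eq_vecI)
      show "dim_vec v = dim_vec w" using v w by (simp add: module_vec_simps)
      fix k assume "k < dim_vec w"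
      then have k: "k < r * c" using w by (simp add: module_vec_simps)
      then have "c > 0" by (cases c) auto
      with k have ij: "k div c < r" "k mod c < c"
        by (auto simp: less_mult_imp_div_less)
      have "T v $$ (k div c, k mod c) = T w $$ (k div c, k mod c)" using eq by simp
      then show "v $ k = w $ k" using ij by (simp add: T_def)
    qed
  qed
  have surj: "T ` carrier ?V = carrier ?M"
  proof
    show "T ` carrier ?V \<subseteq> carrier ?M" by (auto simp: T_def module_mat_simps)
    show "carrier ?M \<subseteq> T ` carrier ?V"
    proof
      fix A assume "A \<in> carrier ?M"
      then have A: "A \<in> carrier_mat r c" by (simp add: module_mat_simps)
      let ?v = "vec (r * c) (\<lambda>k. A $$ (k div c, k mod c))"
      have "A = T ?v" using A ix by (auto simp: T_def)
      moreover have "?v \<in> carrier ?V" by (simp add: module_vec_simps)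
      ultimately show "A \<in> T ` carrier ?V" by (rule image_eqI)
    qed
  qed
  show "vectorspace.fin_dim class_ring ?M"
    using linear_map.surj_fin_dim[OF lm fin_dim surj] .
  show "vectorspace.dim class_ring ?M = r * c"
    using linear_map.dim_eq[OF lm fin_dim inj surj] dim_is_n by simp
qed

lemma mat_subspace_vs:
  fixes V :: "'a :: field mat set"
  assumes "mat_subspace r c V"
  shows "vectorspace class_ring (module_mat TYPE('a) r c\<lparr>carrier := V\<rparr>)"
  using vectorspace.subspace_is_vs[OF matrix_vs] assms subspace_iff_mat_subspace by blast

text \<open>An independent subset of V is independent among all matrices, so its size is bounded. A
  maximal one therefore exists, and it generates V.\<close>

lemma mat_subspace_fin_dim:
  fixes V :: "'a :: field mat set"
  assumes V: "mat_subspace r c V"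
  shows "vectorspace.fin_dim class_ring (module_mat TYPE('a) r c\<lparr>carrier := V\<rparr>)"
proof -
  let ?M = "module_mat TYPE('a) r c"
  interpret M: vectorspace class_ring ?M by (rule matrix_vs)
  interpret W: vectorspace class_ring "?M\<lparr>carrier := V\<rparr>" by (rule mat_subspace_vs[OF V])
  have sm: "submodule class_ring V ?M"
    using V subspace_iff_mat_subspace VectorSpace.subspace.submod by blast
  have li: "finite S \<and> card S \<le> M.dim" if "S \<subseteq> V \<and> W.lin_indpt S" for S
  proof -
    have "M.lin_indpt S" using M.span_li_not_depend(2)[OF _ sm] that by blast
    moreover have "S \<subseteq> carrier ?M" using that V
      by (auto simp: mat_subspace_def module_mat_simps)
    ultimately show ?thesis using M.li_le_dim matrix_vs_fin_dim(1) by blast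
  qed
  have "W.lin_indpt {}" unfolding W.lin_dep_def by auto
  then obtain S where "finite S" and S: "maximal S (\<lambda>S. S \<subseteq> V \<and> W.lin_indpt S)"
    using maximal_exists[of "\<lambda>S. S \<subseteq> V \<and> W.lin_indpt S" "M.dim" "{}"] li by auto
  moreover have "W.gen_set S" using W.max_li_is_gen[of S] S by simp
  ultimately show ?thesis unfolding W.fin_dim_def maximal_def by auto
qed

lemma mat_dim_carrier: "mat_dim r c (carrier_mat r c :: 'a :: field mat set) = r * c"
proof -
  have "module_mat TYPE('a) r c\<lparr>carrier := carrier_mat r c\<rparr> = module_mat TYPE('a) r c"
    by (simp add: module_mat_def)
  then show ?thesis unfolding mat_dim_def using matrix_vs_fin_dim(2) by metis
qed

text \<open>Linearity of T is asked on V only. This form of rank-nullity carries the later dimension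
  counts, with T a block projection or a conjugation.\<close>

lemma mat_dim_rank_nullity:
  fixes V :: "'a :: field mat set"
  assumes V: "mat_subspace r c V"
    and T: "\<And>A. A \<in> V \<Longrightarrow> T A \<in> carrier_mat r' c'"
    and add: "\<And>A B. A \<in> V \<Longrightarrow> B \<in> V \<Longrightarrow> T (A + B) = T A + T B"
    and sm: "\<And>a A. A \<in> V \<Longrightarrow> T (a \<cdot>\<^sub>m A) = a \<cdot>\<^sub>m T A"
  shows "mat_subspace r' c' (T ` V)" (is ?im)
    and "mat_subspace r c {A \<in> V. T A = 0\<^sub>m r' c'}" (is ?ker)
    and "mat_dim r c V = mat_dim r' c' (T ` V) + mat_dim r c {A \<in> V. T A = 0\<^sub>m r' c'}" (is ?dim)
proof -
  let ?M = "module_mat TYPE('a) r c" and ?N = "module_mat TYPE('a) r' c'"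
  interpret M: vectorspace class_ring ?M by (rule matrix_vs)
  interpret N: vectorspace class_ring ?N by (rule matrix_vs)
  interpret W: vectorspace class_ring "?M\<lparr>carrier := V\<rparr>" by (rule mat_subspace_vs[OF V])
  have "T \<in> LinearCombinations.module_hom class_ring (?M\<lparr>carrier := V\<rparr>) ?N"
    unfolding LinearCombinations.module_hom_def using T add sm by (auto simp: module_mat_simps)
  then interpret L: linear_map class_ring "?M\<lparr>carrier := V\<rparr>" ?N T
    unfolding linear_map_def mod_hom_def mod_hom_axioms_def
    using W.module_axioms N.module_axioms W.vectorspace_axioms N.vectorspace_axioms by blast
  have im: "L.im = T ` V" unfolding L.im_def by simp
  have ker: "L.ker = {A \<in> V. T A = 0\<^sub>m r' c'}" unfolding L.ker_def by (simp add: module_mat_simps)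
  show ?im using L.imT_is_subspace unfolding im subspace_iff_mat_subspace .
  have z: "T (0\<^sub>m r c) = 0\<^sub>m r' c'" using L.T0_is_0 by (simp add: module_mat_simps)
  show ?ker using V z unfolding mat_subspace_def by (auto simp: add sm)
  show ?dim using L.rank_nullity[OF mat_subspace_fin_dim[OF V]]
    unfolding im ker mat_dim_def by simp
qed

lemma mat_dim_zero: "mat_dim r c {0\<^sub>m r c :: 'a :: field mat} = 0"
proof -
  have V: "mat_subspace r c {0\<^sub>m r c :: 'a mat}" by (auto simp: mat_subspace_def)
  interpret W: vectorspace class_ring "module_mat TYPE('a) r c\<lparr>carrier := {0\<^sub>m r c}\<rparr>"
    by (rule mat_subspace_vs[OF V])
  have "W.dim \<le> card ({} :: 'a mat set)"
  proof (rule W.gen_ge_dim)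
    show "W.gen_set {}" unfolding W.span_empty by (simp add: module_mat_simps)
  qed auto
  then show ?thesis by (simp add: mat_dim_def)
qed

lemma mat_dim_eq_0_iff:
  fixes V :: "'a :: field mat set"
  assumes V: "mat_subspace r c V"
  shows "mat_dim r c V = 0 \<longleftrightarrow> V = {0\<^sub>m r c}"
proof
  interpret W: vectorspace class_ring "module_mat TYPE('a) r c\<lparr>carrier := V\<rparr>"
    by (rule mat_subspace_vs[OF V])
  assume "mat_dim r c V = 0"
  then have d: "W.dim = 0" by (simp add: mat_dim_def)
  obtain B where "finite B" "W.basis B"
    using W.finite_basis_exists mat_subspace_fin_dim[OF V] by blast
  with d have "W.basis {}" using W.dim_basis by auto
  then have "{\<zero>\<^bsub>module_mat TYPE('a) r c\<lparr>carrier := V\<rparr>\<^esub>} = V"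
    unfolding W.basis_def W.span_empty by simp
  then show "V = {0\<^sub>m r c}" by (simp add: module_mat_simps)
qed (simp add: mat_dim_zero)

text \<open>A basis of V stays independent in W. If the dimensions agree it is a basis of W too, and
  the two spans coincide.\<close>

lemma mat_dim_mono:
  fixes V :: "'a :: field mat set"
  assumes V: "mat_subspace r c V" and W: "mat_subspace r c W" and sub: "V \<subseteq> W"
  shows "mat_dim r c V \<le> mat_dim r c W"
    and "mat_dim r c V = mat_dim r c W \<Longrightarrow> V = W"
proof -
  let ?M = "module_mat TYPE('a) r c"
  interpret M: vectorspace class_ring ?M by (rule matrix_vs)
  interpret V: vectorspace class_ring "?M\<lparr>carrier := V\<rparr>" by (rule mat_subspace_vs[OF V])
  interpret W: vectorspace class_ring "?M\<lparr>carrier := W\<rparr>" by (rule mat_subspace_vs[OF W])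
  have sV: "submodule class_ring V ?M" and sW: "submodule class_ring W ?M"
    using V W subspace_iff_mat_subspace VectorSpace.subspace.submod by blast+
  obtain B where B: "finite B" "V.basis B"
    using V.finite_basis_exists mat_subspace_fin_dim[OF V] by blast
  then have BV: "B \<subseteq> V" and gen: "V.span B = V" and liV: "V.lin_indpt B"
    by (auto simp: V.basis_def)
  have li: "W.lin_indpt B"
    using M.span_li_not_depend(2)[OF _ sV] M.span_li_not_depend(2)[OF _ sW] BV sub liV by blast
  have card: "card B = V.dim" using V.dim_basis B by simp
  show le: "mat_dim r c V \<le> mat_dim r c W"
    using W.li_le_dim(2)[OF mat_subspace_fin_dim[OF W] _ li] BV sub card by (simp add: mat_dim_def)
  assume eq: "mat_dim r c V = mat_dim r c W"
  have "W.basis B"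
    by (rule W.dim_li_is_basis[OF mat_subspace_fin_dim[OF W] B(1) _ li])
      (use BV sub card eq in \<open>auto simp: mat_dim_def\<close>)
  then have "W.span B = W" by (simp add: W.basis_def)
  moreover have "W.span B = V.span B"
    using M.span_li_not_depend(1)[OF _ sV] M.span_li_not_depend(1)[OF _ sW] BV sub by blast
  ultimately show "V = W" using gen by simp
qed

section \<open>Quadratic polynomials, resolvents and digraphs\<close>

lemma quadratically_closed_root:
  fixes b c :: "'a :: field"
  assumes qc: "quadratically_closed TYPE('a)"
  shows "\<exists>x :: 'a. x\<^sup>2 + b * x + c = 0"
proof -
  have "degree [:c, b, 1:] = 2" by simp
  then obtain x where "poly [:c, b, 1:] x = 0"
    using qc unfolding quadratically_closed_def by blast
  then have "x\<^sup>2 + b * x + c = 0" by (simp add: power2_eq_square algebra_simps)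
  then show ?thesis ..
qed

text \<open>The map x^2 - x is surjective, since x^2 - x - y has a root for every y. On a finite
  field it would then be injective, but it sends both 0 and 1 to 0.\<close>

lemma quadratically_closed_infinite:
  assumes qc: "quadratically_closed TYPE('a :: field)"
  shows "infinite (UNIV :: 'a set)"
proof
  assume fin: "finite (UNIV :: 'a set)"
  define f :: "'a \<Rightarrow> 'a" where "f x = x\<^sup>2 - x" for x
  have "surj f"
  proof (rule surjI)
    fix y
    have "\<exists>x. f x = y"
      using quadratically_closed_root[OF qc, of "-1" "-y"] by (auto simp: f_def)
    then show "f (SOME x. f x = y) = y" by (rule someI_ex)
  qed
  then have "inj f" using fin finite_UNIV_surj_inj by blast
  moreover have "f 0 = f 1" by (simp add: f_def)
  ultimately show False by (meson injD zero_neq_one)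
qed

text \<open>The vector (b, r - a) satisfies the first equation identically and the second by the
  characteristic equation. If it vanishes, (r - d, c) does the job, and if that vanishes too the
  matrix is scalar.\<close>

lemma eigenvector_2x2:
  fixes a b c d r :: "'a :: field"
  assumes r: "r\<^sup>2 - (a + d) * r + (a * d - b * c) = 0"
  shows "\<exists>x y. (x \<noteq> 0 \<or> y \<noteq> 0) \<and> a * x + b * y = r * x \<and> c * x + d * y = r * y"
proof -
  consider "b \<noteq> 0 \<or> r \<noteq> a" | "b = 0" "r = a" "r \<noteq> d \<or> c \<noteq> 0" | "b = 0" "r = a" "r = d" "c = 0"
    by blast
  then show ?thesis
  proof cases
    case 1
    show ?thesis
      by (rule exI[of _ b], rule exI[of _ "r - a"])
        (use 1 r in \<open>auto simp: power2_eq_square algebra_simps\<close>)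
  next
    case 2
    show ?thesis
      by (rule exI[of _ "r - d"], rule exI[of _ c])
        (use 2 in \<open>auto simp: algebra_simps\<close>)
  next
    case 3
    then show ?thesis by (intro exI[of _ 1] exI[of _ 0]) auto
  qed
qed

text \<open>The hypothesis \<open>no\<close> says that the matrix has no non-zero eigenvalue. An
  eigenvalue exists because the field is quadratically closed, so it is 0 and the determinant
  vanishes. The trace is then also a root of the characteristic polynomial, hence 0.\<close>

lemma trace_det_2x2_zero:
  fixes a b c d :: "'a :: field"
  assumes qc: "quadratically_closed TYPE('a)"
    and no: "\<And>t x y. x \<noteq> 0 \<or> y \<noteq> 0 \<Longrightarrow> t * (a * x + b * y) = x \<Longrightarrow> t * (c * x + d * y) = y \<Longrightarrow> False"
  shows "d = - a" and "a * d = b * c"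
proof -
  have ev: "r = 0" if "r\<^sup>2 - (a + d) * r + (a * d - b * c) = 0" for r
  proof (rule ccontr)
    assume "r \<noteq> 0"
    obtain x y where "x \<noteq> 0 \<or> y \<noteq> 0" "a * x + b * y = r * x" "c * x + d * y = r * y"
      using eigenvector_2x2[OF \<open>r\<^sup>2 - (a + d) * r + (a * d - b * c) = 0\<close>] by blast
    with no[of x y "inverse r"] \<open>r \<noteq> 0\<close> show False by simp
  qed
  obtain r where r: "r\<^sup>2 - (a + d) * r + (a * d - b * c) = 0"
    using quadratically_closed_root[OF qc, of "- (a + d)" "a * d - b * c"] by (auto simp: algebra_simps)
  with ev have "r = 0" by blast
  with r show det: "a * d = b * c" by simp
  have "a + d = 0" by (rule ev) (simp add: power2_eq_square det)
  then show "d = - a" by (simp add: eq_neg_iff_add_eq_0 add.commute)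
qed

lemma smult_mat_mult_vec:
  fixes A :: "'a :: comm_semiring_0 mat"
  assumes "A \<in> carrier_mat nr nc" "v \<in> carrier_vec nc"
  shows "(k \<cdot>\<^sub>m A) *\<^sub>v v = k \<cdot>\<^sub>v (A *\<^sub>v v)"
  using assms by (intro eq_vecI) auto

text \<open>The adjugate over the polynomial ring turns the resolvent of a line of matrices into a
  polynomial vector.\<close>

lemma polynomial_resolvent:
  fixes A M :: "'a :: field mat" and x :: "'a vec"
  assumes A: "A \<in> carrier_mat n n" and M: "M \<in> carrier_mat n n" and x: "x \<in> carrier_vec n"
  shows "\<exists>D v. (\<forall>s. poly D s = det (1\<^sub>m n - A - s \<cdot>\<^sub>m M)) \<and> v \<in> carrier_vec n \<and>
    (\<forall>s. (1\<^sub>m n - A - s \<cdot>\<^sub>m M) *\<^sub>v map_vec (\<lambda>p. poly p s) v = poly D s \<cdot>\<^sub>v x)"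
proof -
  \<comment> \<open>The matrix 1 - A - sM with s as polynomial variable; its adjugate applied to x
    has polynomial entries.\<close>
  define B where "B = mat n n (\<lambda>(i, j). [:(1\<^sub>m n - A) $$ (i, j), - M $$ (i, j):])"
  define xp where "xp = map_vec (\<lambda>c. [:c:]) x"
  define v where "v = adj_mat B *\<^sub>v xp"
  have B: "B \<in> carrier_mat n n" by (simp add: B_def)
  have xp: "xp \<in> carrier_vec n" using x by (simp add: xp_def)
  have v: "v \<in> carrier_vec n" unfolding v_def using adj_mat(1)[OF B] xp by simp
  have Bv: "B *\<^sub>v v = det B \<cdot>\<^sub>v xp"
  proof -
    have "B *\<^sub>v v = (B * adj_mat B) *\<^sub>v xp"
      unfolding v_def using B adj_mat(1)[OF B] xp by simp
    also have "\<dots> = det B \<cdot>\<^sub>v xp"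
      unfolding adj_mat(2)[OF B] using xp by (simp add: smult_mat_mult_vec[of _ n n])
    finally show ?thesis .
  qed
  have "poly (det B) s = det (1\<^sub>m n - A - s \<cdot>\<^sub>m M) \<and>
    (1\<^sub>m n - A - s \<cdot>\<^sub>m M) *\<^sub>v map_vec (\<lambda>p. poly p s) v = poly (det B) s \<cdot>\<^sub>v x" for s
  proof -
    interpret comm_ring_hom "\<lambda>p :: 'a poly. poly p s" by unfold_locales auto
    have mB: "map_mat (\<lambda>p. poly p s) B = 1\<^sub>m n - A - s \<cdot>\<^sub>m M"
      using A M by (auto simp: B_def)
    have "map_vec (\<lambda>p. poly p s) (B *\<^sub>v v) = map_mat (\<lambda>p. poly p s) B *\<^sub>v map_vec (\<lambda>p. poly p s) v"
      by (rule mult_mat_vec_hom[OF B v])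
    moreover have "map_vec (\<lambda>p. poly p s) (B *\<^sub>v v) = poly (det B) s \<cdot>\<^sub>v x"
      unfolding Bv xp_def by (auto simp: poly_mult)
    ultimately show ?thesis using hom_det[of B] unfolding mB by simp
  qed
  then show ?thesis using v by blast
qed

text \<open>Allows division by a parameter: if s * p(s) = 0 for all s, then p also vanishes at s =
  0.\<close>

lemma poly_eq_0_at_0:
  fixes p :: "'a :: field poly"
  assumes "infinite (UNIV :: 'a set)" and p: "\<And>s. s \<noteq> 0 \<Longrightarrow> poly p s = 0"
  shows "poly p 0 = 0"
proof -
  have "p = 0"
  proof (rule ccontr)
    assume "p \<noteq> 0"
    then have "finite {s. poly p s = 0}" by (rule poly_roots_finite)
    moreover have "UNIV - {0} \<subseteq> {s. poly p s = 0}" using p by auto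
    ultimately have "finite (UNIV - {0 :: 'a})" using finite_subset by blast
    then show False using assms(1) by simp
  qed
  then show ?thesis by simp
qed

lemma det_1_minus_nonzero:
  fixes A :: "'a :: field mat"
  assumes A: "A \<in> carrier_mat n n"
    and no: "\<And>X. X \<in> carrier_vec n \<Longrightarrow> A *\<^sub>v X = X \<Longrightarrow> X = 0\<^sub>v n"
  shows "det (1\<^sub>m n - A) \<noteq> 0"
proof
  assume "det (1\<^sub>m n - A) = 0"
  then obtain X where X: "X \<in> carrier_vec n" "X \<noteq> 0\<^sub>v n" "(1\<^sub>m n - A) *\<^sub>v X = 0\<^sub>v n"
    using det_0_iff_vec_prod_zero_field[of "1\<^sub>m n - A" n, OF minus_carrier_mat[OF A]] by blast
  have "(1\<^sub>m n - A) *\<^sub>v X = X - A *\<^sub>v X"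
    using minus_mult_distrib_mat_vec[OF one_carrier_mat A X(1)] X(1) by simp
  with X have "X - A *\<^sub>v X = 0\<^sub>v n" by simp
  then have "A *\<^sub>v X = X" using A X(1)
    by (metis (no_types, lifting) eq_vecI index_minus_vec(1) index_zero_vec(1) mult_mat_vec_carrier carrier_vecD right_minus_eq)
  with no X show False by blast
qed

text \<open>A minimal nonempty set without sinks in a digraph is a disjoint union of chordless cycles.\<close>

lemma ex_functional_subdigraph:
  fixes P :: "'b \<Rightarrow> 'b \<Rightarrow> bool"
  assumes "finite I" "I \<noteq> {}" "\<And>i. i \<in> I \<Longrightarrow> \<exists>j\<in>I. P i j"
  shows "\<exists>J h. J \<subseteq> I \<and> J \<noteq> {} \<and> (\<forall>i\<in>J. h i \<in> J \<and> (\<forall>j\<in>J. P i j \<longleftrightarrow> j = h i))"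
proof -
  let ?Q = "\<lambda>J. J \<subseteq> I \<and> J \<noteq> {} \<and> (\<forall>i\<in>J. \<exists>j\<in>J. P i j)"
  have "?Q I" using assms by blast
  then obtain J where J: "?Q J" and min: "\<And>J'. ?Q J' \<Longrightarrow> card J \<le> card J'"
    using ex_has_least_nat[of ?Q I card] by blast
  have finJ: "finite J" using J assms(1) finite_subset by blast
  \<comment> \<open>By minimality, deleting k creates a sink i, whose only remaining successor must
    have been k.\<close>
  have "\<exists>i\<in>J. \<forall>j\<in>J. P i j \<longrightarrow> j = k" if k: "k \<in> J" for k
  proof (cases "J = {k}")
    case False
    have "\<not> ?Q (J - {k})"
      using min[of "J - {k}"] card_Diff1_less[OF finJ k] by linarith
    then show ?thesis using J False k by auto
  qed auto
  then obtain g where g: "\<And>k. k \<in> J \<Longrightarrow> g k \<in> J \<and> (\<forall>j\<in>J. P (g k) j \<longrightarrow> j = k)" by metis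
  \<comment> \<open>The vertex \<open>g k\<close> has k as its only successor in J, so k can be
    recovered from it. On a finite set g is then onto, which means that every vertex of J has
    exactly one successor in J.\<close>
  have "inj_on g J"
  proof (rule inj_onI)
    fix k l assume kl: "k \<in> J" "l \<in> J" "g k = g l"
    obtain j where "j \<in> J" "P (g k) j" using g[OF kl(1)] J by blast
    then show "k = l" using g[OF kl(1)] g[OF kl(2)] kl(3) by metis
  qed
  moreover have "g ` J \<subseteq> J" using g by blast
  ultimately have surj: "g ` J = J" using endo_inj_surj[OF finJ] by blast
  have "\<exists>k. k \<in> J \<and> (\<forall>j\<in>J. P i j \<longleftrightarrow> j = k)" if "i \<in> J" for i
  proof -
    have "i \<in> g ` J" using surj that by simp
    then obtain k where k: "k \<in> J" "i = g k" by blast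
    have "\<exists>j\<in>J. P i j" using J that by simp
    then have "\<forall>j\<in>J. P i j \<longleftrightarrow> j = k" using g[OF k(1)] unfolding k(2) by blast
    then show ?thesis using k(1) by blast
  qed
  then obtain h where "\<forall>i\<in>J. h i \<in> J \<and> (\<forall>j\<in>J. P i j \<longleftrightarrow> j = h i)" by metis
  then show ?thesis using J by blast
qed

section \<open>Conjugation and adapted basis vectors\<close>

definition trivial_spectrum_space :: "nat \<Rightarrow> 'a :: field mat set \<Rightarrow> bool" where
  "trivial_spectrum_space n V \<longleftrightarrow> mat_subspace n n V \<and> trivial_spectrum n V"

definition inverse_pair :: "nat \<Rightarrow> 'a :: field mat \<Rightarrow> 'a mat \<Rightarrow> bool" where
  "inverse_pair n P Q \<longleftrightarrow> P \<in> carrier_mat n n \<and> Q \<in> carrier_mat n n \<and> P * Q = 1\<^sub>m n \<and> Q * P = 1\<^sub>m n"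

text \<open>Only an inclusion is required, so that the property can be assembled from diagonal
  blocks. For spaces of dimension n choose 2, \<open>triangularizable_full\<close> upgrades it to an
  equality.\<close>

definition triangularizable :: "nat \<Rightarrow> 'a :: field mat set \<Rightarrow> bool" where
  "triangularizable n V \<longleftrightarrow>
     (\<exists>P Q. inverse_pair n P Q \<and> (\<forall>M\<in>V. Q * M * P \<in> strict_upper_triangular_mats n))"

definition block :: "nat \<Rightarrow> nat \<Rightarrow> nat \<Rightarrow> nat \<Rightarrow> 'a mat \<Rightarrow> 'a mat" where
  "block r0 c0 r c M = mat r c (\<lambda>(i, j). M $$ (r0 + i, c0 + j))"

lemma maximal_trivial_spectrum_subspace_iff:
  fixes V :: "'a :: field mat set"
  shows "maximal_trivial_spectrum_subspace n V \<longleftrightarrow>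
    trivial_spectrum_space n V \<and> mat_dim n n V = n choose 2"
  unfolding maximal_trivial_spectrum_subspace_def trivial_spectrum_space_def mat_dim_def
    subspace_iff_mat_subspace by blast

lemma mat_subspaceD:
  assumes "mat_subspace r c V"
  shows "M \<in> V \<Longrightarrow> M \<in> carrier_mat r c" "0\<^sub>m r c \<in> V"
    "M \<in> V \<Longrightarrow> N \<in> V \<Longrightarrow> M + N \<in> V" "M \<in> V \<Longrightarrow> a \<cdot>\<^sub>m M \<in> V"
  using assms unfolding mat_subspace_def by blast+

lemma trivial_spectrum_spaceD:
  assumes "trivial_spectrum_space n V"
  shows "mat_subspace n n V" "M \<in> V \<Longrightarrow> M \<in> carrier_mat n n" "0\<^sub>m n n \<in> V"
    "M \<in> V \<Longrightarrow> N \<in> V \<Longrightarrow> M + N \<in> V" "M \<in> V \<Longrightarrow> a \<cdot>\<^sub>m M \<in> V"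
    "M \<in> V \<Longrightarrow> X \<in> carrier_vec n \<Longrightarrow> M *\<^sub>v X = X \<Longrightarrow> X = 0\<^sub>v n"
  using assms mat_subspaceD unfolding trivial_spectrum_space_def trivial_spectrum_def by blast+

lemma mult_mat_vec_index:
  assumes "M \<in> carrier_mat r c" "X \<in> carrier_vec c" "i < r"
  shows "(M *\<^sub>v X) $ i = (\<Sum>j = 0..<c. M $$ (i, j) * X $ j)"
  using assms by (auto simp: scalar_prod_def)

text \<open>Closure under linear combinations, stated entrywise so that no finite sum of matrices of
  a fixed size has to be formed.\<close>

lemma mat_subspace_sum:
  fixes V :: "'a :: field mat set"
  assumes V: "mat_subspace r c V" and "finite J" and "\<And>i. i \<in> J \<Longrightarrow> Y i \<in> V"
  shows "\<exists>M\<in>V. \<forall>k<r. \<forall>j<c. M $$ (k, j) = (\<Sum>i\<in>J. t i * Y i $$ (k, j))"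
  using assms(2,3)
proof (induction J)
  case empty
  then show ?case using mat_subspaceD(2)[OF V] by (intro bexI[of _ "0\<^sub>m r c"]) auto
next
  case (insert x J)
  then obtain M where M: "M \<in> V" "\<forall>k<r. \<forall>j<c. M $$ (k, j) = (\<Sum>i\<in>J. t i * Y i $$ (k, j))"
    by auto
  have Y: "Y x \<in> V" using insert by simp
  show ?case
  proof (rule bexI[of _ "t x \<cdot>\<^sub>m Y x + M"])
    show "t x \<cdot>\<^sub>m Y x + M \<in> V" using Y M mat_subspaceD[OF V] by blast
    show "\<forall>k<r. \<forall>j<c. (t x \<cdot>\<^sub>m Y x + M) $$ (k, j) = (\<Sum>i\<in>insert x J. t i * Y i $$ (k, j))"
      using insert.hyps M(2) mat_subspaceD(1)[OF V M(1)] mat_subspaceD(1)[OF V Y] by auto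
  qed
qed

section \<open>Dimensions of injective images and of spaces of blocks\<close>

lemma mat_dim_inj_image:
  fixes V :: "'a :: field mat set"
  assumes V: "mat_subspace r c V"
    and T: "\<And>A. A \<in> V \<Longrightarrow> T A \<in> carrier_mat r' c'"
    and add: "\<And>A B. A \<in> V \<Longrightarrow> B \<in> V \<Longrightarrow> T (A + B) = T A + T B"
    and sm: "\<And>a A. A \<in> V \<Longrightarrow> T (a \<cdot>\<^sub>m A) = a \<cdot>\<^sub>m T A"
    and inj: "\<And>A. A \<in> V \<Longrightarrow> T A = 0\<^sub>m r' c' \<Longrightarrow> A = 0\<^sub>m r c"
  shows "mat_dim r' c' (T ` V) = mat_dim r c V"
proof -
  note rn = mat_dim_rank_nullity[of r c V T, OF V T add sm]
  have "0\<^sub>m r c \<in> {A \<in> V. T A = 0\<^sub>m r' c'}"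
    using mat_subspaceD(2)[OF rn(2)] by blast
  then have "{A \<in> V. T A = 0\<^sub>m r' c'} = {0\<^sub>m r c}" using inj by blast
  then show ?thesis using rn(3) mat_dim_zero by simp
qed

lemma block_add:
  assumes "A \<in> carrier_mat n n'" "B \<in> carrier_mat n n'" "r0 + r \<le> n" "c0 + c \<le> n'"
  shows "block r0 c0 r c (A + B) = block r0 c0 r c A + block r0 c0 r c B"
  using assms by (auto simp: block_def)

lemma block_smult:
  assumes "A \<in> carrier_mat n n'" "r0 + r \<le> n" "c0 + c \<le> n'"
  shows "block r0 c0 r c (a \<cdot>\<^sub>m A) = a \<cdot>\<^sub>m block r0 c0 r c A"
  using assms by (auto simp: block_def)

lemma block_carrier [simp]: "block r0 c0 r c M \<in> carrier_mat r c"
  by (simp add: block_def)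

lemma dim_block [simp]: "dim_row (block r0 c0 r c M) = r" "dim_col (block r0 c0 r c M) = c"
  by (simp_all add: block_def)

lemma block_index [simp]: "i < r \<Longrightarrow> j < c \<Longrightarrow> block r0 c0 r c M $$ (i, j) = M $$ (r0 + i, c0 + j)"
  by (simp add: block_def)

lemma mat_dim_block:
  fixes V :: "'a :: field mat set"
  assumes V: "mat_subspace n n' V" and "r0 + r \<le> n" "c0 + c \<le> n'"
  shows "mat_subspace r c (block r0 c0 r c ` V)"
    and "mat_subspace n n' {A \<in> V. block r0 c0 r c A = 0\<^sub>m r c}"
    and "mat_dim n n' V = mat_dim r c (block r0 c0 r c ` V) + mat_dim n n' {A \<in> V. block r0 c0 r c A = 0\<^sub>m r c}"
proof -
  note c = mat_subspaceD(1)[OF V]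
  note rn = mat_dim_rank_nullity[OF V, of "block r0 c0 r c" r c,
      OF block_carrier block_add[OF c c assms(2,3)] block_smult[OF c assms(2,3)]]
  show "mat_subspace r c (block r0 c0 r c ` V)"
    "mat_subspace n n' {A \<in> V. block r0 c0 r c A = 0\<^sub>m r c}"
    "mat_dim n n' V = mat_dim r c (block r0 c0 r c ` V) + mat_dim n n' {A \<in> V. block r0 c0 r c A = 0\<^sub>m r c}"
    using rn by blast+
qed

lemma mat_dim_le: "mat_subspace r c V \<Longrightarrow> mat_dim r c (V :: 'a :: field mat set) \<le> r * c"
  using mat_dim_mono(1)[of r c V "carrier_mat r c"] mat_dim_carrier[of r c, where ?'a = 'a]
  by (auto simp: mat_subspace_def)

lemma mat_dim_fullD:
  fixes V :: "'a :: field mat set"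
  assumes "mat_subspace r c V" "mat_dim r c V = r * c"
  shows "V = carrier_mat r c"
  using mat_dim_mono(2)[of r c V "carrier_mat r c"] mat_dim_carrier[of r c, where ?'a = 'a] assms
  by (auto simp: mat_subspace_def)

section \<open>Change of basis\<close>

lemma inverse_pairD:
  assumes "inverse_pair n P Q"
  shows "P \<in> carrier_mat n n" "Q \<in> carrier_mat n n" "P * Q = 1\<^sub>m n" "Q * P = 1\<^sub>m n"
  using assms by (auto simp: inverse_pair_def)

lemma inverse_pair_conj:
  assumes PQ: "inverse_pair n P Q" and M: "M \<in> carrier_mat n n"
  shows "P * (Q * M * P) * Q = M"
proof -
  note pq = inverse_pairD[OF PQ]
  have "P * (Q * M * P) * Q = (P * Q) * M * (P * Q)"
    using pq(1,2) M by (simp add: assoc_mult_mat[of _ n n _ n _ n])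
  then show ?thesis using pq M by simp
qed

lemma inverse_pair_mult:
  assumes "inverse_pair n P Q" "inverse_pair n P' Q'"
  shows "inverse_pair n (P * P') (Q' * Q)"
proof -
  note a = inverse_pairD[OF assms(1)] and b = inverse_pairD[OF assms(2)]
  have "P * P' * (Q' * Q) = P * (P' * Q') * Q"
    using a(1,2) b(1,2) by (simp add: assoc_mult_mat[of _ n n _ n _ n])
  moreover have "Q' * Q * (P * P') = Q' * (Q * P) * P'"
    using a(1,2) b(1,2) by (simp add: assoc_mult_mat[of _ n n _ n _ n])
  ultimately show ?thesis using a b unfolding inverse_pair_def by simp
qed

lemma conj_add:
  fixes P Q :: "'a :: field mat"
  assumes "P \<in> carrier_mat n n" "Q \<in> carrier_mat n n" "A \<in> carrier_mat n n" "B \<in> carrier_mat n n"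
  shows "Q * (A + B) * P = Q * A * P + Q * B * P"
  using assms by (simp add: mult_add_distrib_mat[of _ n n] add_mult_distrib_mat[of _ n n])

lemma conj_smult:
  fixes P Q :: "'a :: field mat"
  assumes "P \<in> carrier_mat n n" "Q \<in> carrier_mat n n" "A \<in> carrier_mat n n"
  shows "Q * (a \<cdot>\<^sub>m A) * P = a \<cdot>\<^sub>m (Q * A * P)"
  using assms by (simp add: mult_smult_distrib[of _ n n] mult_smult_assoc_mat[of _ n n])

lemma mat_dim_conj:
  fixes V :: "'a :: field mat set"
  assumes PQ: "inverse_pair n P Q" and V: "mat_subspace n n V"
  shows "mat_subspace n n ((\<lambda>M. Q * M * P) ` V)"
    and "mat_dim n n ((\<lambda>M. Q * M * P) ` V) = mat_dim n n V"
proof -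
  note pq = inverse_pairD[OF PQ]
  note V' = mat_subspaceD[OF V]
  have c: "Q * A * P \<in> carrier_mat n n" if "A \<in> V" for A using pq V'(1)[OF that] by simp
  note add = conj_add[OF pq(1,2) V'(1) V'(1)] and sm = conj_smult[OF pq(1,2) V'(1)]
  show "mat_subspace n n ((\<lambda>M. Q * M * P) ` V)"
    by (rule mat_dim_rank_nullity(1)[OF V c add sm])
  show "mat_dim n n ((\<lambda>M. Q * M * P) ` V) = mat_dim n n V"
  proof (rule mat_dim_inj_image[OF V c add sm])
    fix A assume A: "A \<in> V" and "Q * A * P = 0\<^sub>m n n"
    then show "A = 0\<^sub>m n n"
      using inverse_pair_conj[OF PQ V'(1)[OF A]] pq(1,2) by simp
  qed
qed

text \<open>If Q M P fixes X, then M fixes P X.\<close>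

lemma trivial_spectrum_space_conj:
  fixes V :: "'a :: field mat set"
  assumes PQ: "inverse_pair n P Q" and V: "trivial_spectrum_space n V"
  shows "trivial_spectrum_space n ((\<lambda>M. Q * M * P) ` V)"
  unfolding trivial_spectrum_space_def
proof
  note pq = inverse_pairD[OF PQ]
  note V' = trivial_spectrum_spaceD[OF V]
  show "mat_subspace n n ((\<lambda>M. Q * M * P) ` V)" by (rule mat_dim_conj(1)[OF PQ V'(1)])
  show "trivial_spectrum n ((\<lambda>M. Q * M * P) ` V)"
    unfolding trivial_spectrum_def
  proof (rule ballI, rule notI, elim bexE conjE)
    fix N X assume "N \<in> (\<lambda>M. Q * M * P) ` V" and X: "X \<in> carrier_vec n" "X \<noteq> 0\<^sub>v n" "N *\<^sub>v X = X"
    then obtain M where M: "M \<in> V" "N = Q * M * P" by blast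
    have Mc: "M \<in> carrier_mat n n" using V'(2) M by blast
    have Nc: "N \<in> carrier_mat n n" using M Mc pq by simp
    have PX: "P *\<^sub>v X \<in> carrier_vec n" using pq X by simp
    have "P * N = M * P"
    proof -
      have "P * N = (P * Q) * M * P" unfolding M(2) using pq(1,2) Mc
        by (simp add: assoc_mult_mat[of _ n n _ n _ n])
      then show ?thesis using pq Mc by simp
    qed
    then have "M *\<^sub>v (P *\<^sub>v X) = (P * N) *\<^sub>v X" using Mc pq X by simp
    also have "\<dots> = P *\<^sub>v X" using X Nc pq(1) by simp
    finally have "P *\<^sub>v X = 0\<^sub>v n" using V'(6)[OF M(1) PX] by blast
    then have "(Q * P) *\<^sub>v X = Q *\<^sub>v 0\<^sub>v n" using pq(1,2) X(1) by simp
    also have "Q *\<^sub>v 0\<^sub>v n = 0\<^sub>v n" using pq(2) by auto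
    finally have "X = 0\<^sub>v n" using pq X(1) by simp
    with X show False by blast
  qed
qed

lemma triangularizable_conjD:
  fixes V :: "'a :: field mat set"
  assumes PQ: "inverse_pair n P Q" and V: "V \<subseteq> carrier_mat n n"
    and t: "triangularizable n ((\<lambda>M. Q * M * P) ` V)"
  shows "triangularizable n V"
proof -
  obtain P' Q' where pq': "inverse_pair n P' Q'"
    and t: "\<forall>M\<in>V. Q' * (Q * M * P) * P' \<in> strict_upper_triangular_mats n"
    using t unfolding triangularizable_def by auto
  note a = inverse_pairD[OF PQ] and b = inverse_pairD[OF pq']
  have "Q' * Q * M * (P * P') = Q' * (Q * M * P) * P'" if "M \<in> V" for M
  proof -
    have "M \<in> carrier_mat n n" using V that by blast
    then show ?thesis using a(1,2) b(1,2) by (simp add: assoc_mult_mat[of _ n n _ n _ n])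
  qed
  then show ?thesis using inverse_pair_mult[OF PQ pq'] t unfolding triangularizable_def by metis
qed

text \<open>Matrices in \<open>V\<close> supported on single rows, one for each row, would combine along a chordless
  cycle of their supports to a matrix that fixes a 0-1 vector.\<close>

lemma ex_adapted_row:
  fixes V :: "'a :: field mat set"
  assumes V: "trivial_spectrum_space n V" and n: "n > 0"
  shows "\<exists>i<n. \<forall>M\<in>V. (\<forall>k<n. k \<noteq> i \<longrightarrow> (\<forall>j<n. M $$ (k, j) = 0)) \<longrightarrow> M = 0\<^sub>m n n"
proof (rule ccontr)
  note V' = trivial_spectrum_spaceD[OF V]
  assume "\<not> ?thesis"
  then have "\<forall>i. \<exists>M. i < n \<longrightarrow> M \<in> V \<and> (\<forall>k<n. k \<noteq> i \<longrightarrow> (\<forall>j<n. M $$ (k, j) = 0)) \<and> M \<noteq> 0\<^sub>m n n"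
    by blast
  then obtain Y where "\<forall>i. i < n \<longrightarrow> Y i \<in> V \<and> (\<forall>k<n. k \<noteq> i \<longrightarrow> (\<forall>j<n. Y i $$ (k, j) = 0)) \<and> Y i \<noteq> 0\<^sub>m n n"
    by metis
  then have YV: "\<And>i. i < n \<Longrightarrow> Y i \<in> V"
    and Y0: "\<And>i k j. i < n \<Longrightarrow> k < n \<Longrightarrow> k \<noteq> i \<Longrightarrow> j < n \<Longrightarrow> Y i $$ (k, j) = 0"
    and Yn: "\<And>i. i < n \<Longrightarrow> Y i \<noteq> 0\<^sub>m n n" by blast+
  have ex: "\<exists>j\<in>{..<n}. Y i $$ (i, j) \<noteq> 0" if i: "i \<in> {..<n}" for i
  proof (rule ccontr)
    assume c: "\<not> ?thesis"
    have "Y i = 0\<^sub>m n n"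
    proof (rule eq_matI)
      fix k j assume "k < dim_row (0\<^sub>m n n :: 'a mat)" "j < dim_col (0\<^sub>m n n :: 'a mat)"
      then show "Y i $$ (k, j) = 0\<^sub>m n n $$ (k, j)" using c Y0[of i k j] i by (cases "k = i") auto
    qed (use V'(2)[OF YV] i in auto)
    with Yn i show False by simp
  qed
  have "{..<n} \<noteq> {}" using n by auto
  \<comment> \<open>There is an edge from i to j when row i of \<open>Y i\<close>, its only non-zero
    row, has a non-zero entry in column j.\<close>
  from ex_functional_subdigraph[OF finite_lessThan this, of "\<lambda>i j. Y i $$ (i, j) \<noteq> 0"] ex
  obtain J h where J: "J \<subseteq> {..<n}" "J \<noteq> {}"
    and h: "\<And>i. i \<in> J \<Longrightarrow> h i \<in> J" "\<And>i j. i \<in> J \<Longrightarrow> j \<in> J \<Longrightarrow> Y i $$ (i, j) \<noteq> 0 \<longleftrightarrow> j = h i"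
    by blast
  have finJ: "finite J" using J finite_subset by blast
  \<comment> \<open>The factors normalise the entry (i, h i) to 1. Within the columns of J, row i of
    M then has a single entry 1, at \<open>h i\<close>, and the rows outside J are zero, so M fixes
    the indicator vector X of J.\<close>
  define t where "t i = inverse (Y i $$ (i, h i))" for i
  obtain M where M: "M \<in> V" and Me: "\<And>k j. k < n \<Longrightarrow> j < n \<Longrightarrow> M $$ (k, j) = (\<Sum>i\<in>J. t i * Y i $$ (k, j))"
    using mat_subspace_sum[OF V'(1) finJ, of Y t] YV J by blast
  define X :: "'a vec" where "X = vec n (\<lambda>i. if i \<in> J then 1 else 0)"
  have Mk: "M $$ (k, j) = (if k \<in> J then t k * Y k $$ (k, j) else 0)" if "k < n" "j < n" for k j
  proof -
    have "(\<Sum>i\<in>J. t i * Y i $$ (k, j)) = (\<Sum>i\<in>J. if i = k then t k * Y k $$ (k, j) else 0)"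
      by (rule sum.cong[OF refl]) (use Y0 that J in auto)
    then show ?thesis using Me[OF that] finJ by simp
  qed
  have "M *\<^sub>v X = X"
  proof (rule eq_vecI)
    fix k assume "k < dim_vec X"
    then have k: "k < n" by (simp add: X_def)
    have "(M *\<^sub>v X) $ k = (\<Sum>j = 0..<n. M $$ (k, j) * X $ j)"
      by (rule mult_mat_vec_index[OF V'(2)[OF M] _ k]) (simp add: X_def)
    also have "\<dots> = (\<Sum>j = 0..<n. if k \<in> J \<and> j = h k then 1 else 0)"
    proof (rule sum.cong[OF refl])
      fix j assume "j \<in> {0..<n}"
      then have j: "j < n" by simp
      show "M $$ (k, j) * X $ j = (if k \<in> J \<and> j = h k then 1 else 0)"
      proof (cases "k \<in> J")
        case True
        then have "Y k $$ (k, h k) \<noteq> 0" using h by blast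
        then show ?thesis using Mk[OF k j] j True h(1)[OF True] h(2)[OF True, of j]
          by (auto simp: X_def t_def)
      qed (use Mk[OF k j] in simp)
    qed
    also have "\<dots> = X $ k" using k h(1)[of k] J by (auto simp: X_def)
    finally show "(M *\<^sub>v X) $ k = X $ k" .
  qed (use V'(2)[OF M] in \<open>simp add: X_def\<close>)
  then have "X = 0\<^sub>v n" using V'(6)[OF M] by (simp add: X_def)
  moreover obtain i where i: "i \<in> J" using J by blast
  ultimately have "X $ i = 0" using J by auto
  with i J show False by (auto simp: X_def)
qed

section \<open>The dimension bound and block triangular spaces\<close>

lemma four_block_blocks:
  assumes "M \<in> carrier_mat (p + q) (p + q)"
  shows "M = four_block_mat (block 0 0 p p M) (block 0 p p q M) (block p 0 q p M) (block p p q q M)"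
  using assms by (intro eq_matI) (auto simp: block_def)

lemma zero_mult_mat_vec:
  "v \<in> carrier_vec c \<Longrightarrow> 0\<^sub>m r c *\<^sub>v v = (0\<^sub>v r :: 'a :: semiring_0 vec)"
  by (intro eq_vecI) auto

text \<open>1 - A is invertible, with the inverse given by its adjugate. This completes a fixed
  vector of the lower diagonal block to one of a whole block triangular matrix.\<close>

lemma affine_fixed_point:
  fixes V :: "'a :: field mat set"
  assumes V: "trivial_spectrum_space n V" and A: "A \<in> V" and b: "b \<in> carrier_vec n"
  shows "\<exists>v\<in>carrier_vec n. A *\<^sub>v v + b = v"
proof -
  note V' = trivial_spectrum_spaceD[OF V]
  have Ac: "A \<in> carrier_mat n n" using V'(2)[OF A] .
  define B where "B = 1\<^sub>m n - A"
  have B: "B \<in> carrier_mat n n" unfolding B_def by (rule minus_carrier_mat[OF Ac])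
  have d: "det B \<noteq> 0" unfolding B_def using det_1_minus_nonzero[OF Ac] V'(6)[OF A] by blast
  note adj = adj_mat[OF B]
  define v where "v = inverse (det B) \<cdot>\<^sub>v (adj_mat B *\<^sub>v b)"
  have v: "v \<in> carrier_vec n" using adj(1) b by (simp add: v_def)
  have "B *\<^sub>v v = inverse (det B) \<cdot>\<^sub>v ((B * adj_mat B) *\<^sub>v b)"
    unfolding v_def using B adj(1) b by (simp add: mult_mat_vec[of _ n n])
  also have "\<dots> = b" unfolding adj(2) using b d
    by (simp add: smult_mat_mult_vec[of _ n n] smult_smult_assoc)
  finally have "v - A *\<^sub>v v = b"
    unfolding B_def using minus_mult_distrib_mat_vec[OF one_carrier_mat Ac v] v by simp
  then have "A *\<^sub>v v + b = v" using v Ac b by auto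
  then show ?thesis using v by blast
qed

text \<open>The size is \<open>Suc m\<close>, so the last index is m. The rows above it vanish
  exactly when the image lies in the line of the last basis vector.\<close>

definition adapted_last :: "nat \<Rightarrow> 'a :: zero mat set \<Rightarrow> bool" where
  "adapted_last m V \<longleftrightarrow>
     (\<forall>M\<in>V. (\<forall>k<m. \<forall>j<Suc m. M $$ (k, j) = 0) \<longrightarrow> M = 0\<^sub>m (Suc m) (Suc m))"

text \<open>The corner entry (m, m) is left free here; a trivial spectrum forces it to vanish, by
  \<open>ker_last_col\<close>, so these are the members of V that kill the last basis
  vector.\<close>

definition ker_last :: "nat \<Rightarrow> 'a :: zero mat set \<Rightarrow> 'a mat set" where
  "ker_last m V = {M \<in> V. block 0 m m 1 M = 0\<^sub>m m 1}"

text \<open>Swapping two coordinates moves the index found in \<open>ex_adapted_row\<close> to the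
  last place. The swap is its own inverse.\<close>

lemma ex_adapted_last:
  fixes V :: "'a :: field mat set"
  assumes V: "trivial_spectrum_space (Suc m) V"
  shows "\<exists>P Q. inverse_pair (Suc m) P Q \<and> adapted_last m ((\<lambda>M. Q * M * P) ` V)"
proof -
  note V' = trivial_spectrum_spaceD[OF V]
  obtain i where i: "i < Suc m"
    and ad: "\<And>M. M \<in> V \<Longrightarrow> (\<forall>k<Suc m. k \<noteq> i \<longrightarrow> (\<forall>j<Suc m. M $$ (k, j) = 0)) \<Longrightarrow> M = 0\<^sub>m (Suc m) (Suc m)"
    using ex_adapted_row[OF V] by auto
  define S :: "'a mat" where "S = swaprows_mat (Suc m) i m"
  have Sc: "S \<in> carrier_mat (Suc m) (Suc m)" by (simp add: S_def)
  have SS: "S * S = 1\<^sub>m (Suc m)" unfolding S_def using i by (intro swaprows_mat_inv) auto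
  have pair: "inverse_pair (Suc m) S S" using Sc SS by (simp add: inverse_pair_def)
  have "adapted_last m ((\<lambda>M. S * M * S) ` V)"
    unfolding adapted_last_def
  proof (intro ballI impI, elim imageE)
    fix N M assume N: "\<forall>k<m. \<forall>j<Suc m. N $$ (k, j) = 0" and eq: "N = S * M * S" and M: "M \<in> V"
    have Mc: "M \<in> carrier_mat (Suc m) (Suc m)" using V'(2)[OF M] .
    have Nc: "N \<in> carrier_mat (Suc m) (Suc m)" using eq Sc Mc by simp
    have NS: "(N * S) $$ (k, j) = 0" if "k < m" "j < Suc m" for k j
      using that N Nc Sc by (simp add: scalar_prod_def)
    have "M = S * (N * S)"
      using inverse_pair_conj[OF pair Mc] Nc Sc eq by (simp add: assoc_mult_mat[of _ "Suc m" "Suc m" _ "Suc m" _ "Suc m"])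
    also have "\<dots> = swaprows i m (N * S)"
      unfolding S_def using i Nc by (intro swaprows_mat[symmetric, of _ _ "Suc m"]) auto
    finally have Me: "M = swaprows i m (N * S)" .
    have "M = 0\<^sub>m (Suc m) (Suc m)"
    proof (rule ad[OF M], intro allI impI)
      fix k j assume "k < Suc m" "k \<noteq> i" "j < Suc m"
      then show "M $$ (k, j) = 0" unfolding Me using Nc Sc NS i by auto
    qed
    then show "N = 0\<^sub>m (Suc m) (Suc m)" using eq Sc by simp
  qed
  then show ?thesis using pair by blast
qed

text \<open>If the corner entry were some a distinct from 0, then M / a would fix the last basis
  vector.\<close>

lemma ker_last_col:
  fixes V :: "'a :: field mat set"
  assumes V: "trivial_spectrum_space (Suc m) V" and M: "M \<in> ker_last m V" and i: "i < Suc m"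
  shows "M $$ (i, m) = 0"
proof -
  note V' = trivial_spectrum_spaceD[OF V]
  have MV: "M \<in> V" and b: "block 0 m m 1 M = 0\<^sub>m m 1" using M by (auto simp: ker_last_def)
  have Mc: "M \<in> carrier_mat (Suc m) (Suc m)" using V'(2)[OF MV] .
  have z: "M $$ (k, m) = 0" if "k < m" for k
  proof -
    have "block 0 m m 1 M $$ (k, 0) = 0" using b that by simp
    then show ?thesis using that by simp
  qed
  have "M $$ (m, m) = 0"
  proof (rule ccontr)
    assume a: "M $$ (m, m) \<noteq> 0"
    let ?N = "inverse (M $$ (m, m)) \<cdot>\<^sub>m M"
    have "?N *\<^sub>v unit_vec (Suc m) m = unit_vec (Suc m) m"
    proof (rule eq_vecI)
      fix k assume "k < dim_vec (unit_vec (Suc m) m :: 'a vec)"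
      then show "(?N *\<^sub>v unit_vec (Suc m) m) $ k = (unit_vec (Suc m) m :: 'a vec) $ k"
        using Mc a z[of k] by (cases "k = m") auto
    qed (use Mc in auto)
    then have "unit_vec (Suc m) m = (0\<^sub>v (Suc m) :: 'a vec)"
      using V'(6)[OF V'(5)[OF MV]] by simp
    then have "(unit_vec (Suc m) m :: 'a vec) $ m = 0" by simp
    then show False by simp
  qed
  then show ?thesis using z i by (cases "i = m") auto
qed

text \<open>The corner is the action on the quotient by the last basis vector. A fixed vector X of
  the corner extends to the fixed vector (X, L X) of M, with L the last row, because the last column
  is zero. A member of \<open>ker_last\<close> with zero corner has only its last row left, so
  adaptedness makes it zero and no dimension is lost.\<close>

lemma corner_space:
  fixes V :: "'a :: field mat set"
  assumes V: "trivial_spectrum_space (Suc m) V" and ad: "adapted_last m V"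
  shows "mat_subspace (Suc m) (Suc m) (ker_last m V)"
    and "trivial_spectrum_space m (block 0 0 m m ` ker_last m V)"
    and "mat_dim (Suc m) (Suc m) V =
      mat_dim m 1 (block 0 m m 1 ` V) + mat_dim m m (block 0 0 m m ` ker_last m V)"
proof -
  note V' = trivial_spectrum_spaceD[OF V]
  have le: "0 + m \<le> Suc m" "m + 1 \<le> Suc m" by auto
  note T1 = mat_dim_block[OF V'(1) le, folded ker_last_def]
  show U: "mat_subspace (Suc m) (Suc m) (ker_last m V)" by (rule T1(2))
  have UV: "ker_last m V \<subseteq> V" by (auto simp: ker_last_def)
  note T2 = mat_dim_block[OF U le(1) le(1)]
  have ker0: "M = 0\<^sub>m (Suc m) (Suc m)" if M: "M \<in> ker_last m V" and b: "block 0 0 m m M = 0\<^sub>m m m" for M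
  proof -
    have "M $$ (k, j) = 0" if k: "k < m" and j: "j < Suc m" for k j
    proof (cases "j = m")
      case False
      then have "block 0 0 m m M $$ (k, j) = 0" using b k j by simp
      then show ?thesis using k j False by simp
    qed (use ker_last_col[OF V M] k in auto)
    then show ?thesis using ad M UV unfolding adapted_last_def by blast
  qed
  have "{M \<in> ker_last m V. block 0 0 m m M = 0\<^sub>m m m} = {0\<^sub>m (Suc m) (Suc m)}"
    using ker0 mat_subspaceD(2)[OF T2(2)] by blast
  then have "mat_dim (Suc m) (Suc m) (ker_last m V) = mat_dim m m (block 0 0 m m ` ker_last m V)"
    using T2(3) mat_dim_zero[of "Suc m" "Suc m"] by simp
  then show "mat_dim (Suc m) (Suc m) V =
      mat_dim m 1 (block 0 m m 1 ` V) + mat_dim m m (block 0 0 m m ` ker_last m V)"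
    using T1(3) by simp
  show "trivial_spectrum_space m (block 0 0 m m ` ker_last m V)"
    unfolding trivial_spectrum_space_def
  proof
    show "mat_subspace m m (block 0 0 m m ` ker_last m V)" by (rule T2(1))
    show "trivial_spectrum m (block 0 0 m m ` ker_last m V)"
      unfolding trivial_spectrum_def
    proof (rule ballI, rule notI, elim bexE conjE imageE)
      fix N X M assume X: "X \<in> carrier_vec m" "X \<noteq> 0\<^sub>v m" "N *\<^sub>v X = X"
        and N: "N = block 0 0 m m M" and M: "M \<in> ker_last m V"
      have MV: "M \<in> V" using M UV by blast
      have Mc: "M \<in> carrier_mat (m + 1) (m + 1)" using V'(2)[OF MV] by simp
      let ?L = "block m 0 1 m M"
      have fb: "M = four_block_mat N (0\<^sub>m m 1) ?L (0\<^sub>m 1 1)"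
      proof -
        have "block m m 1 1 M = 0\<^sub>m 1 1" using ker_last_col[OF V M] by (auto simp: block_def)
        then show ?thesis using four_block_blocks[OF Mc] M N by (simp add: ker_last_def)
      qed
      have Lc: "?L *\<^sub>v X \<in> carrier_vec 1" by (rule mult_mat_vec_carrier[OF block_carrier X(1)])
      have Nc: "N \<in> carrier_mat m m" by (simp add: N)
      have "M *\<^sub>v (X @\<^sub>v ?L *\<^sub>v X) = four_block_mat N (0\<^sub>m m 1) ?L (0\<^sub>m 1 1) *\<^sub>v (X @\<^sub>v ?L *\<^sub>v X)"
        using fb by simp
      also have "\<dots> = (N *\<^sub>v X + 0\<^sub>m m 1 *\<^sub>v (?L *\<^sub>v X)) @\<^sub>v (?L *\<^sub>v X + 0\<^sub>m 1 1 *\<^sub>v (?L *\<^sub>v X))"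
        by (rule four_block_mat_mult_vec[OF Nc zero_carrier_mat block_carrier zero_carrier_mat X(1) Lc])
      also have "\<dots> = X @\<^sub>v ?L *\<^sub>v X"
        unfolding zero_mult_mat_vec[OF Lc] using X Lc by simp
      finally have "M *\<^sub>v (X @\<^sub>v ?L *\<^sub>v X) = X @\<^sub>v ?L *\<^sub>v X" .
      then have "X @\<^sub>v ?L *\<^sub>v X = 0\<^sub>v (Suc m)"
        using V'(6)[OF MV, of "X @\<^sub>v ?L *\<^sub>v X"] append_carrier_vec[OF X(1) Lc] by simp
      then have "(X @\<^sub>v ?L *\<^sub>v X) $ i = 0" if "i < m" for i using that by simp
      then have "X = 0\<^sub>v m" using X(1) Lc by (intro eq_vecI) auto
      with X show False by blast
    qed
  qed
qed

lemma choose_2_Suc: "Suc m choose 2 = m + (m choose 2)"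
  by (simp add: numeral_2_eq_2)

text \<open>In an adapted basis the last column contributes at most m dimensions and the corner, by
  induction, at most m choose 2.\<close>

theorem mat_dim_trivial_spectrum_le:
  fixes V :: "'a :: field mat set"
  assumes "trivial_spectrum_space n V"
  shows "mat_dim n n V \<le> n choose 2"
  using assms
proof (induction n arbitrary: V)
  case 0
  then show ?case using mat_dim_le[OF trivial_spectrum_spaceD(1)[OF 0]] by simp
next
  case (Suc m)
  obtain P Q where PQ: "inverse_pair (Suc m) P Q" and ad: "adapted_last m ((\<lambda>M. Q * M * P) ` V)"
    using ex_adapted_last[OF Suc.prems] by blast
  let ?W = "(\<lambda>M. Q * M * P) ` V"
  have W: "trivial_spectrum_space (Suc m) ?W" by (rule trivial_spectrum_space_conj[OF PQ Suc.prems])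
  have "mat_dim m 1 (block 0 m m 1 ` ?W) \<le> m"
    using mat_dim_le[of m 1] mat_dim_block(1)[OF trivial_spectrum_spaceD(1)[OF W], of 0 m m 1] by simp
  moreover have "mat_dim m m (block 0 0 m m ` ker_last m ?W) \<le> m choose 2"
    by (rule Suc.IH[OF corner_space(2)[OF W ad]])
  ultimately show ?case
    using corner_space(3)[OF W ad] mat_dim_conj(2)[OF PQ trivial_spectrum_spaceD(1)[OF Suc.prems]]
      choose_2_Suc[of m] by linarith
qed

text \<open>Equality in the dimension bound forces equality in both of its summands.\<close>

lemma maximal_corner_space:
  fixes V :: "'a :: field mat set"
  assumes V: "trivial_spectrum_space (Suc m) V" and ad: "adapted_last m V"
    and d: "mat_dim (Suc m) (Suc m) V = Suc m choose 2"
  shows "block 0 m m 1 ` V = carrier_mat m 1"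
    and "mat_dim m m (block 0 0 m m ` ker_last m V) = m choose 2"
proof -
  have s: "mat_subspace m 1 (block 0 m m 1 ` V)"
    using mat_dim_block(1)[OF trivial_spectrum_spaceD(1)[OF V], of 0 m m 1] by simp
  have "mat_dim m 1 (block 0 m m 1 ` V) \<le> m" using mat_dim_le[OF s] by simp
  moreover have "mat_dim m m (block 0 0 m m ` ker_last m V) \<le> m choose 2"
    by (rule mat_dim_trivial_spectrum_le[OF corner_space(2)[OF V ad]])
  ultimately have e: "mat_dim m 1 (block 0 m m 1 ` V) = m"
    "mat_dim m m (block 0 0 m m ` ker_last m V) = m choose 2"
    using corner_space(3)[OF V ad] d choose_2_Suc[of m] by linarith+
  then show "mat_dim m m (block 0 0 m m ` ker_last m V) = m choose 2" by simp
  show "block 0 m m 1 ` V = carrier_mat m 1" using mat_dim_fullD[OF s] e by simp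
qed

text \<open>A fixed vector X of the upper block gives (X, 0). A fixed vector Z of the lower block
  gives (X, Z), where X solves an affine equation for the upper block. The off-diagonal block has at
  most p * q dimensions, and the three bounds sum to (p + q) choose 2, so none of them can be
  strict.\<close>

lemma block_triangular_spaces:
  fixes V :: "'a :: field mat set"
  assumes V: "trivial_spectrum_space (p + q) V" and d: "mat_dim (p + q) (p + q) V = (p + q) choose 2"
    and tri: "\<And>M. M \<in> V \<Longrightarrow> block p 0 q p M = 0\<^sub>m q p"
  shows "trivial_spectrum_space p (block 0 0 p p ` V)" (is "?A p")
    and "trivial_spectrum_space q (block p p q q ` V)" (is "?D q")
    and "mat_dim p p (block 0 0 p p ` V) = p choose 2"
    and "mat_dim q q (block p p q q ` V) = q choose 2"
proof -
  note V' = trivial_spectrum_spaceD[OF V]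
  have le: "0 + p \<le> p + q" "p + q \<le> p + q" by auto
  have mult: "M *\<^sub>v (X @\<^sub>v Z) = (block 0 0 p p M *\<^sub>v X + block 0 p p q M *\<^sub>v Z) @\<^sub>v (block p p q q M *\<^sub>v Z)"
    if M: "M \<in> V" and X: "X \<in> carrier_vec p" and Z: "Z \<in> carrier_vec q" for M X Z
  proof -
    have "M *\<^sub>v (X @\<^sub>v Z) = (block 0 0 p p M *\<^sub>v X + block 0 p p q M *\<^sub>v Z) @\<^sub>v
        (block p 0 q p M *\<^sub>v X + block p p q q M *\<^sub>v Z)"
      by (subst four_block_blocks[OF V'(2)[OF M]])
        (rule four_block_mat_mult_vec[OF block_carrier block_carrier block_carrier block_carrier X Z])
    then show ?thesis
      unfolding tri[OF M] zero_mult_mat_vec[OF X] using mult_mat_vec_carrier[OF block_carrier Z] by simp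
  qed
  have zero: "X = 0\<^sub>v p" "Z = 0\<^sub>v q"
    if eq: "X @\<^sub>v Z = 0\<^sub>v (p + q)" and X: "X \<in> carrier_vec p" and Z: "Z \<in> carrier_vec q" for X Z :: "'a vec"
  proof -
    have "(X @\<^sub>v Z) = 0\<^sub>v p @\<^sub>v 0\<^sub>v q" unfolding eq by (intro eq_vecI) auto
    then show "X = 0\<^sub>v p" "Z = 0\<^sub>v q" using append_vec_eq[OF X zero_carrier_vec] by auto
  qed
  show A: "?A p"
    unfolding trivial_spectrum_space_def
  proof
    show "mat_subspace p p (block 0 0 p p ` V)" by (rule mat_dim_block(1)[OF V'(1) le(1) le(1)])
    show "trivial_spectrum p (block 0 0 p p ` V)"
      unfolding trivial_spectrum_def
    proof (rule ballI, rule notI, elim bexE conjE imageE)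
      fix N X M assume X: "X \<in> carrier_vec p" "X \<noteq> 0\<^sub>v p" "N *\<^sub>v X = X"
        and N: "N = block 0 0 p p M" and M: "M \<in> V"
      have "block 0 p p q M *\<^sub>v 0\<^sub>v q = 0\<^sub>v p" "block p p q q M *\<^sub>v 0\<^sub>v q = 0\<^sub>v q"
        by (auto simp: block_def scalar_prod_def)
      then have "M *\<^sub>v (X @\<^sub>v 0\<^sub>v q) = X @\<^sub>v 0\<^sub>v q"
        using mult[OF M X(1) zero_carrier_vec] X N by simp
      then have "X @\<^sub>v 0\<^sub>v q = 0\<^sub>v (p + q)"
        using V'(6)[OF M append_carrier_vec[OF X(1) zero_carrier_vec]] by blast
      then show False using zero(1)[OF _ X(1) zero_carrier_vec] X(2) by blast
    qed
  qed
  show D: "?D q"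
    unfolding trivial_spectrum_space_def
  proof
    show "mat_subspace q q (block p p q q ` V)" by (rule mat_dim_block(1)[OF V'(1) le(2) le(2)])
    show "trivial_spectrum q (block p p q q ` V)"
      unfolding trivial_spectrum_def
    proof (rule ballI, rule notI, elim bexE conjE imageE)
      fix N Z M assume Z: "Z \<in> carrier_vec q" "Z \<noteq> 0\<^sub>v q" "N *\<^sub>v Z = Z"
        and N: "N = block p p q q M" and M: "M \<in> V"
      obtain X where X: "X \<in> carrier_vec p" "block 0 0 p p M *\<^sub>v X + block 0 p p q M *\<^sub>v Z = X"
        using affine_fixed_point[OF A imageI[OF M] mult_mat_vec_carrier[OF block_carrier Z(1)]] by blast
      then have "M *\<^sub>v (X @\<^sub>v Z) = X @\<^sub>v Z" using mult[OF M X(1) Z(1)] Z N by simp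
      then have "X @\<^sub>v Z = 0\<^sub>v (p + q)"
        using V'(6)[OF M append_carrier_vec[OF X(1) Z(1)]] by blast
      then show False using zero(2)[OF _ X(1) Z(1)] Z(2) by blast
    qed
  qed
  \<comment> \<open>Rank-nullity is applied three times, removing the upper, the lower and the
    off-diagonal block in turn. The lower blocks of \<open>V1\<close> may be fewer than those of V,
    hence the comparison by inclusion below.\<close>
  define V1 where "V1 = {M \<in> V. block 0 0 p p M = 0\<^sub>m p p}"
  define V2 where "V2 = {M \<in> V1. block p p q q M = 0\<^sub>m q q}"
  note T1 = mat_dim_block[OF V'(1) le(1) le(1), folded V1_def]
  note T2 = mat_dim_block[OF T1(2) le(2) le(2), folded V2_def]
  note T3 = mat_dim_block[OF T2(2) le(1) le(2)]
  have "M = 0\<^sub>m (p + q) (p + q)" if "M \<in> V2" "block 0 p p q M = 0\<^sub>m p q" for M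
  proof -
    have m: "M \<in> V" "block 0 0 p p M = 0\<^sub>m p p" "block p p q q M = 0\<^sub>m q q"
      using that by (auto simp: V1_def V2_def)
    then show ?thesis using four_block_blocks[OF V'(2)[OF m(1)]] tri[OF m(1)] that(2) by simp
  qed
  then have "{M \<in> V2. block 0 p p q M = 0\<^sub>m p q} = {0\<^sub>m (p + q) (p + q)}"
    using mat_subspaceD(2)[OF T3(2)] by blast
  then have "mat_dim (p + q) (p + q) V2 = mat_dim p q (block 0 p p q ` V2)"
    using T3(3) mat_dim_zero[of "p + q" "p + q"] by simp
  then have "mat_dim (p + q) (p + q) V2 \<le> p * q" using mat_dim_le[OF T3(1)] by simp
  moreover have "mat_dim p p (block 0 0 p p ` V) \<le> p choose 2" by (rule mat_dim_trivial_spectrum_le[OF A])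
  moreover have "block p p q q ` V1 \<subseteq> block p p q q ` V" by (auto simp: V1_def)
  then have "mat_dim q q (block p p q q ` V1) \<le> mat_dim q q (block p p q q ` V)"
    by (rule mat_dim_mono(1)[OF T2(1) trivial_spectrum_spaceD(1)[OF D]])
  moreover have "mat_dim q q (block p p q q ` V) \<le> q choose 2" by (rule mat_dim_trivial_spectrum_le[OF D])
  moreover have "(p + q) choose 2 = (p choose 2) + (q choose 2) + p * q"
    by (induction p) (simp_all add: choose_2_Suc)
  ultimately show "mat_dim p p (block 0 0 p p ` V) = p choose 2"
    and "mat_dim q q (block p p q q ` V) = q choose 2"
    using d T1(3) T2(3) by linarith+
qed

section \<open>Block diagonal changes of basis\<close>

lemma inverse_pair_diag:
  fixes P1 Q1 P2 Q2 :: "'a :: field mat"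
  assumes "inverse_pair p P1 Q1" "inverse_pair q P2 Q2"
  shows "inverse_pair (p + q) (four_block_mat P1 (0\<^sub>m p q) (0\<^sub>m q p) P2)
    (four_block_mat Q1 (0\<^sub>m p q) (0\<^sub>m q p) Q2)"
proof -
  note a = inverse_pairD[OF assms(1)] and b = inverse_pairD[OF assms(2)]
  have z: "0\<^sub>m p q \<in> carrier_mat p q" "0\<^sub>m q p \<in> carrier_mat q p" by auto
  show ?thesis unfolding inverse_pair_def
    mult_four_block_mat[OF a(1) z b(1) a(2) z b(2)] mult_four_block_mat[OF a(2) z b(2) a(1) z b(1)]
    using a b by simp
qed

lemma conj_diag_blocks:
  fixes P1 Q1 P2 Q2 M :: "'a :: field mat"
  assumes "inverse_pair p P1 Q1" "inverse_pair q P2 Q2" and M: "M \<in> carrier_mat (p + q) (p + q)"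
  shows "four_block_mat Q1 (0\<^sub>m p q) (0\<^sub>m q p) Q2 * M * four_block_mat P1 (0\<^sub>m p q) (0\<^sub>m q p) P2 =
    four_block_mat (Q1 * block 0 0 p p M * P1) (Q1 * block 0 p p q M * P2)
      (Q2 * block p 0 q p M * P1) (Q2 * block p p q q M * P2)"
proof -
  note a = inverse_pairD(1,2)[OF assms(1)] and b = inverse_pairD(1,2)[OF assms(2)]
  have z: "0\<^sub>m p q \<in> carrier_mat p q" "0\<^sub>m q p \<in> carrier_mat q p" by auto
  let ?A = "block 0 0 p p M" and ?B = "block 0 p p q M" and ?C = "block p 0 q p M" and ?D = "block p p q q M"
  have c: "?A \<in> carrier_mat p p" "?B \<in> carrier_mat p q" "?C \<in> carrier_mat q p" "?D \<in> carrier_mat q q"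
    by auto
  have "four_block_mat Q1 (0\<^sub>m p q) (0\<^sub>m q p) Q2 * M =
      four_block_mat Q1 (0\<^sub>m p q) (0\<^sub>m q p) Q2 * four_block_mat ?A ?B ?C ?D"
    using four_block_blocks[OF M] by simp
  also have "\<dots> = four_block_mat (Q1 * ?A) (Q1 * ?B) (Q2 * ?C) (Q2 * ?D)"
    unfolding mult_four_block_mat[OF a(2) z b(2) c]
    using a b c by (intro cong_four_block_mat) (auto simp del: block_carrier)
  finally have 1: "four_block_mat Q1 (0\<^sub>m p q) (0\<^sub>m q p) Q2 * M =
    four_block_mat (Q1 * ?A) (Q1 * ?B) (Q2 * ?C) (Q2 * ?D)" .
  have c': "Q1 * ?A \<in> carrier_mat p p" "Q1 * ?B \<in> carrier_mat p q" "Q2 * ?C \<in> carrier_mat q p"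
    "Q2 * ?D \<in> carrier_mat q q" using a b c by auto
  show ?thesis unfolding 1 mult_four_block_mat[OF c' a(1) z b(1)]
  proof (rule cong_four_block_mat)
    show "Q1 * ?A * P1 + Q1 * ?B * 0\<^sub>m q p = Q1 * ?A * P1"
      unfolding right_mult_zero_mat[OF c'(2)] by (rule right_add_zero_mat[OF mult_carrier_mat[OF c'(1) a(1)]])
    show "Q1 * ?A * 0\<^sub>m p q + Q1 * ?B * P2 = Q1 * ?B * P2"
      unfolding right_mult_zero_mat[OF c'(1)] by (rule left_add_zero_mat[OF mult_carrier_mat[OF c'(2) b(1)]])
    show "Q2 * ?C * P1 + Q2 * ?D * 0\<^sub>m q p = Q2 * ?C * P1"
      unfolding right_mult_zero_mat[OF c'(4)] by (rule right_add_zero_mat[OF mult_carrier_mat[OF c'(3) a(1)]])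
    show "Q2 * ?C * 0\<^sub>m p q + Q2 * ?D * P2 = Q2 * ?D * P2"
      unfolding right_mult_zero_mat[OF c'(3)] by (rule left_add_zero_mat[OF mult_carrier_mat[OF c'(4) b(1)]])
  qed
qed

lemma triangularizable_block:
  fixes V :: "'a :: field mat set"
  assumes V: "V \<subseteq> carrier_mat (p + q) (p + q)"
    and tri: "\<And>M. M \<in> V \<Longrightarrow> block p 0 q p M = 0\<^sub>m q p"
    and A: "triangularizable p (block 0 0 p p ` V)" and D: "triangularizable q (block p p q q ` V)"
  shows "triangularizable (p + q) V"
proof -
  obtain P1 Q1 where pq1: "inverse_pair p P1 Q1"
    and A: "\<And>M. M \<in> V \<Longrightarrow> Q1 * block 0 0 p p M * P1 \<in> strict_upper_triangular_mats p"
    using A unfolding triangularizable_def by blast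
  obtain P2 Q2 where pq2: "inverse_pair q P2 Q2"
    and D: "\<And>M. M \<in> V \<Longrightarrow> Q2 * block p p q q M * P2 \<in> strict_upper_triangular_mats q"
    using D unfolding triangularizable_def by blast
  have "four_block_mat Q1 (0\<^sub>m p q) (0\<^sub>m q p) Q2 * M * four_block_mat P1 (0\<^sub>m p q) (0\<^sub>m q p) P2
      \<in> strict_upper_triangular_mats (p + q)" if M: "M \<in> V" for M
  proof -
    have Mc: "M \<in> carrier_mat (p + q) (p + q)" using V M by blast
    have "Q2 * block p 0 q p M * P1 = 0\<^sub>m q p"
      unfolding tri[OF M] using inverse_pairD[OF pq1] inverse_pairD[OF pq2] by simp
    then show ?thesis
      unfolding conj_diag_blocks[OF pq1 pq2 Mc]
      using A[OF M] D[OF M] inverse_pairD(1,2)[OF pq1] inverse_pairD(1,2)[OF pq2]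
      by (auto simp: strict_upper_triangular_mats_def index_mat_four_block(1) simp del: index_mult_mat(1))
  qed
  then show ?thesis using inverse_pair_diag[OF pq1 pq2] unfolding triangularizable_def by blast
qed

section \<open>Perturbations of low rank\<close>

lemma zero_smult_vec: "u \<in> carrier_vec n \<Longrightarrow> (0 :: 'a :: semiring_0) \<cdot>\<^sub>v u = 0\<^sub>v n"
  by (intro eq_vecI) auto

text \<open>Makes scalar products with a resolvent vector polynomial in s, as
  \<open>poly_eq_0_at_0\<close> requires.\<close>

lemma functional_polynomial:
  fixes u :: "'a :: field vec"
  assumes "u \<in> carrier_vec n" "v \<in> carrier_vec n"
  shows "\<exists>p. \<forall>s. poly p s = u \<bullet> map_vec (\<lambda>q. poly q s) v"
  by (rule exI[of _ "\<Sum>i = 0..<n. Polynomial.smult (u $ i) (v $ i)"])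
    (use assms in \<open>auto simp: poly_sum scalar_prod_def\<close>)

lemma resolvent_mult_vec:
  fixes A M :: "'a :: field mat"
  assumes A: "A \<in> carrier_mat n n" and M: "M \<in> carrier_mat n n" and X: "X \<in> carrier_vec n"
  shows "(1\<^sub>m n - A - s \<cdot>\<^sub>m M) *\<^sub>v X = X - A *\<^sub>v X - s \<cdot>\<^sub>v (M *\<^sub>v X)"
proof -
  have "(1\<^sub>m n - A - s \<cdot>\<^sub>m M) *\<^sub>v X = (1\<^sub>m n - A) *\<^sub>v X - (s \<cdot>\<^sub>m M) *\<^sub>v X"
    by (rule minus_mult_distrib_mat_vec[OF minus_carrier_mat[OF A] smult_carrier_mat[OF M] X])
  also have "(1\<^sub>m n - A) *\<^sub>v X = 1\<^sub>m n *\<^sub>v X - A *\<^sub>v X"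
    by (rule minus_mult_distrib_mat_vec[OF one_carrier_mat A X])
  finally show ?thesis using X smult_mat_mult_vec[OF M X] by simp
qed

text \<open>The vector v(s) is the inverse of 1 - A - sM applied to x, multiplied by the
  determinant, which is non-zero for every s by the trivial spectrum. Solving for v(s) gives the
  recursion that the perturbation arguments substitute into itself.\<close>

lemma ex_resolvent_line:
  fixes V :: "'a :: field mat set"
  assumes V: "trivial_spectrum_space n V" and A: "A \<in> V" and M: "M \<in> V" and x: "x \<in> carrier_vec n"
  shows "\<exists>v. v \<in> carrier_vec n \<and> (\<forall>s. det (1\<^sub>m n - A - s \<cdot>\<^sub>m M) \<noteq> 0 \<and>
    map_vec (\<lambda>p. poly p s) v = A *\<^sub>v map_vec (\<lambda>p. poly p s) v + s \<cdot>\<^sub>v (M *\<^sub>v map_vec (\<lambda>p. poly p s) v)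
      + det (1\<^sub>m n - A - s \<cdot>\<^sub>m M) \<cdot>\<^sub>v x)"
proof -
  note V' = trivial_spectrum_spaceD[OF V]
  have Ac: "A \<in> carrier_mat n n" and Mc: "M \<in> carrier_mat n n" using V'(2) A M by blast+
  obtain D v where D: "\<And>s. poly D s = det (1\<^sub>m n - A - s \<cdot>\<^sub>m M)" and v: "v \<in> carrier_vec n"
    and eq: "\<And>s. (1\<^sub>m n - A - s \<cdot>\<^sub>m M) *\<^sub>v map_vec (\<lambda>p. poly p s) v = poly D s \<cdot>\<^sub>v x"
    using polynomial_resolvent[OF Ac Mc x] by blast
  have "det (1\<^sub>m n - A - s \<cdot>\<^sub>m M) \<noteq> 0 \<and>
    map_vec (\<lambda>p. poly p s) v = A *\<^sub>v map_vec (\<lambda>p. poly p s) v + s \<cdot>\<^sub>v (M *\<^sub>v map_vec (\<lambda>p. poly p s) v)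
      + det (1\<^sub>m n - A - s \<cdot>\<^sub>m M) \<cdot>\<^sub>v x" for s
  proof
    have B: "A + s \<cdot>\<^sub>m M \<in> V" using V'(4,5) A M by blast
    have "1\<^sub>m n - A - s \<cdot>\<^sub>m M = 1\<^sub>m n - (A + s \<cdot>\<^sub>m M)" using Ac Mc by auto
    then show "det (1\<^sub>m n - A - s \<cdot>\<^sub>m M) \<noteq> 0"
      using det_1_minus_nonzero[OF V'(2)[OF B]] V'(6)[OF B] by simp
    let ?v = "map_vec (\<lambda>p. poly p s) v"
    have vc: "?v \<in> carrier_vec n" using v by simp
    have e: "?v - A *\<^sub>v ?v - s \<cdot>\<^sub>v (M *\<^sub>v ?v) = det (1\<^sub>m n - A - s \<cdot>\<^sub>m M) \<cdot>\<^sub>v x"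
      using eq[of s] resolvent_mult_vec[OF Ac Mc vc, of s] D[of s] by simp
    have c: "A *\<^sub>v ?v \<in> carrier_vec n" "M *\<^sub>v ?v \<in> carrier_vec n" using Ac Mc vc by auto
    show "?v = A *\<^sub>v ?v + s \<cdot>\<^sub>v (M *\<^sub>v ?v) + det (1\<^sub>m n - A - s \<cdot>\<^sub>m M) \<cdot>\<^sub>v x"
      unfolding e[symmetric] using vc c Ac Mc by (intro eq_vecI) (auto simp del: index_mult_mat_vec)
  qed
  then show ?thesis using v by blast
qed

text \<open>Rank one case: \<open>1 - s M - t x y\<^sup>T\<close> is singular for some \<open>t\<close> unless \<open>y\<^sup>T (1 - s M)\<^sup>-\<^sup>1 x\<close> vanishes, so all
  coefficients of this power series in \<open>s\<close> vanish.\<close>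

lemma rank_one_perturbation:
  fixes V :: "'a :: field mat set"
  assumes inf: "infinite (UNIV :: 'a set)" and V: "trivial_spectrum_space n V"
    and A: "A \<in> V" and M: "M \<in> V"
    and x: "x \<in> carrier_vec n" and y: "y \<in> carrier_vec n"
    and Axy: "\<And>X. X \<in> carrier_vec n \<Longrightarrow> A *\<^sub>v X = (y \<bullet> X) \<cdot>\<^sub>v x"
  shows "y \<bullet> (M *\<^sub>v x) = 0" and "y \<bullet> (M *\<^sub>v (M *\<^sub>v x)) = 0"
proof -
  note V' = trivial_spectrum_spaceD[OF V]
  have Ac: "A \<in> carrier_mat n n" and Mc: "M \<in> carrier_mat n n" using V'(2) A M by blast+
  obtain v where v: "v \<in> carrier_vec n"
    and D: "\<And>s. det (1\<^sub>m n - 0\<^sub>m n n - s \<cdot>\<^sub>m M) \<noteq> 0"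
    and res: "\<And>s. map_vec (\<lambda>p. poly p s) v = 0\<^sub>m n n *\<^sub>v map_vec (\<lambda>p. poly p s) v
      + s \<cdot>\<^sub>v (M *\<^sub>v map_vec (\<lambda>p. poly p s) v) + det (1\<^sub>m n - 0\<^sub>m n n - s \<cdot>\<^sub>m M) \<cdot>\<^sub>v x"
    using ex_resolvent_line[OF V V'(3) M x] by blast
  \<comment> \<open>With 0 in place of A in the resolvent, \<open>w s\<close> is d(s) times the
    inverse of 1 - sM applied to x.\<close>
  define w where "w s = map_vec (\<lambda>p. poly p s) v" for s
  define d where "d s = det (1\<^sub>m n - 0\<^sub>m n n - s \<cdot>\<^sub>m M)" for s
  have wc: "w s \<in> carrier_vec n" for s using v by (simp add: w_def)
  have Mw: "M *\<^sub>v w s \<in> carrier_vec n" "M *\<^sub>v (M *\<^sub>v w s) \<in> carrier_vec n" for s using Mc wc by auto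
  have Mx: "M *\<^sub>v x \<in> carrier_vec n" using Mc x by auto
  have d0: "d s \<noteq> 0" for s using D by (simp add: d_def)
  have w: "w s = s \<cdot>\<^sub>v (M *\<^sub>v w s) + d s \<cdot>\<^sub>v x" for s
    using res[of s] zero_mult_mat_vec[OF wc[of s], of n] Mw(1)[of s] unfolding w_def d_def by simp
  have Mw_eq: "M *\<^sub>v w s = s \<cdot>\<^sub>v (M *\<^sub>v (M *\<^sub>v w s)) + d s \<cdot>\<^sub>v (M *\<^sub>v x)" for s
    by (subst (1) w) (use Mc Mw x in \<open>simp add: mult_add_distrib_mat_vec[of _ n n] mult_mat_vec[of _ n n]\<close>)
  have yw: "y \<bullet> w s = 0" for s
  proof (rule ccontr)
    assume a: "y \<bullet> w s \<noteq> 0"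
    \<comment> \<open>Chosen so that t A sends \<open>w s\<close> to d(s) x, the term by which s M
      fails to fix \<open>w s\<close>.\<close>
    define t where "t = d s / (y \<bullet> w s)"
    have "(s \<cdot>\<^sub>m M + t \<cdot>\<^sub>m A) *\<^sub>v w s = s \<cdot>\<^sub>v (M *\<^sub>v w s) + t \<cdot>\<^sub>v (A *\<^sub>v w s)"
      using Ac Mc wc[of s] by (simp add: add_mult_distrib_mat_vec[of _ n n] smult_mat_mult_vec[of _ n n])
    also have "t \<cdot>\<^sub>v (A *\<^sub>v w s) = d s \<cdot>\<^sub>v x"
      unfolding Axy[OF wc] t_def using a by (simp add: smult_smult_assoc)
    also have "s \<cdot>\<^sub>v (M *\<^sub>v w s) + d s \<cdot>\<^sub>v x = w s" using w by simp
    finally have "w s = 0\<^sub>v n" using V'(6)[OF V'(4)[OF V'(5)[OF M] V'(5)[OF A]] wc] by blast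
    then show False using a y by simp
  qed
  have transp: "y \<bullet> (M *\<^sub>v X) = (M\<^sup>T *\<^sub>v y) \<bullet> X" if "X \<in> carrier_vec n" for X
    using transpose_vec_mult_scalar[OF Mc that y] by simp
  have Mty: "M\<^sup>T *\<^sub>v y \<in> carrier_vec n" "M\<^sup>T *\<^sub>v (M\<^sup>T *\<^sub>v y) \<in> carrier_vec n" using Mc y by auto
  have transp2: "y \<bullet> (M *\<^sub>v (M *\<^sub>v X)) = (M\<^sup>T *\<^sub>v (M\<^sup>T *\<^sub>v y)) \<bullet> X" if "X \<in> carrier_vec n" for X
    using transp[of "M *\<^sub>v X"] transpose_vec_mult_scalar[OF Mc that Mty(1)] Mc that by simp
  have w0: "w 0 = d 0 \<cdot>\<^sub>v x" using w[of 0] x unfolding zero_smult_vec[OF Mw(1)] by simp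
  obtain p1 where p1: "\<And>s. poly p1 s = y \<bullet> (M *\<^sub>v w s)"
    using functional_polynomial[OF Mty(1) v] transp[OF wc] w_def by metis
  obtain p2 where p2: "\<And>s. poly p2 s = y \<bullet> (M *\<^sub>v (M *\<^sub>v w s))"
    using functional_polynomial[OF Mty(2) v] transp2[OF wc] w_def by metis
  have yx: "y \<bullet> x = 0" using yw[of 0] d0[of 0] x y unfolding w0 by simp
  \<comment> \<open>Substituting the recursion for w into y . w = 0 leaves a factor s. Dividing by
    it and setting s = 0 gives y . M x = 0; a second round with M w in place of w gives y . M M x =
    0.\<close>
  have 1: "s * (y \<bullet> (M *\<^sub>v w s)) = 0" for s
  proof -
    have "y \<bullet> w s = s * (y \<bullet> (M *\<^sub>v w s)) + d s * (y \<bullet> x)"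
      by (subst (1) w) (use y x Mw[of s] in \<open>simp add: scalar_prod_add_distrib[of _ n]\<close>)
    then show ?thesis using yw yx by simp
  qed
  have p1z: "poly p1 0 = 0" by (rule poly_eq_0_at_0[OF inf]) (use 1 p1 in auto)
  have "y \<bullet> (M *\<^sub>v w 0) = d 0 * (y \<bullet> (M *\<^sub>v x))"
    unfolding w0 using Mc x y Mx by (simp add: mult_mat_vec[of _ n n])
  then show yMx: "y \<bullet> (M *\<^sub>v x) = 0" using p1z p1[of 0] d0[of 0] by simp
  have yMw: "y \<bullet> (M *\<^sub>v w s) = 0" for s using 1[of s] p1z p1[of 0] by (cases "s = 0") auto
  have 2: "s * (y \<bullet> (M *\<^sub>v (M *\<^sub>v w s))) = 0" for s
  proof -
    have "y \<bullet> (M *\<^sub>v w s) = s * (y \<bullet> (M *\<^sub>v (M *\<^sub>v w s))) + d s * (y \<bullet> (M *\<^sub>v x))"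
      by (subst (1) Mw_eq) (use y Mx Mw[of s] in \<open>simp add: scalar_prod_add_distrib[of _ n]\<close>)
    then show ?thesis using yMw yMx by simp
  qed
  have p2z: "poly p2 0 = 0" by (rule poly_eq_0_at_0[OF inf]) (use 2 p2 in auto)
  have "y \<bullet> (M *\<^sub>v (M *\<^sub>v w 0)) = d 0 * (y \<bullet> (M *\<^sub>v (M *\<^sub>v x)))"
    unfolding w0 using Mc x y Mx by (simp add: mult_mat_vec[of _ n n])
  then show "y \<bullet> (M *\<^sub>v (M *\<^sub>v x)) = 0" using p2z p2[of 0] d0[of 0] by simp
qed

text \<open>Rank two case \<open>A = x y\<^sup>T + e l\<^sup>T\<close>: the 2-by-2 matrix of \<open>(y, l)\<^sup>T (1 - A' - s M)\<^sup>-\<^sup>1 (x, e)\<close> has no nonzero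
  eigenvalue, so it has trace and determinant zero; the conclusion is the coefficient of \<open>s\<close> in the determinant.\<close>

lemma rank_two_perturbation:
  fixes V :: "'a :: field mat set"
  assumes qc: "quadratically_closed TYPE('a)" and V: "trivial_spectrum_space n V"
    and A: "A \<in> V" and A': "A' \<in> V" and M: "M \<in> V"
    and x: "x \<in> carrier_vec n" and y: "y \<in> carrier_vec n"
    and e: "e \<in> carrier_vec n" and l: "l \<in> carrier_vec n" and z: "z \<in> carrier_vec n"
    and Axy: "\<And>X. X \<in> carrier_vec n \<Longrightarrow> A *\<^sub>v X = (y \<bullet> X) \<cdot>\<^sub>v x + (l \<bullet> X) \<cdot>\<^sub>v e"
    and indep: "\<And>a b. a \<cdot>\<^sub>v x + b \<cdot>\<^sub>v e = 0\<^sub>v n \<Longrightarrow> a = 0 \<and> b = 0"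
    and yA': "\<And>X. X \<in> carrier_vec n \<Longrightarrow> y \<bullet> (A' *\<^sub>v X) = 0"
    and yx: "y \<bullet> x = 0" and ye: "y \<bullet> e = 0" and A'e: "A' *\<^sub>v e = 0\<^sub>v n"
    and z_eq: "A' *\<^sub>v z + x = z" and yMe: "y \<bullet> (M *\<^sub>v e) \<noteq> 0"
  shows "l \<bullet> z = 0"
proof -
  note inf = quadratically_closed_infinite[OF qc]
  note V' = trivial_spectrum_spaceD[OF V]
  have Ac: "A \<in> carrier_mat n n" and A'c: "A' \<in> carrier_mat n n" and Mc: "M \<in> carrier_mat n n"
    using V'(2) A A' M by blast+
  define d where "d s = det (1\<^sub>m n - A' - s \<cdot>\<^sub>m M)" for s
  obtain v0 where v0: "v0 \<in> carrier_vec n"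
    and D: "\<And>s. det (1\<^sub>m n - A' - s \<cdot>\<^sub>m M) \<noteq> 0"
    and resv: "\<And>s. map_vec (\<lambda>p. poly p s) v0 = A' *\<^sub>v map_vec (\<lambda>p. poly p s) v0
      + s \<cdot>\<^sub>v (M *\<^sub>v map_vec (\<lambda>p. poly p s) v0) + det (1\<^sub>m n - A' - s \<cdot>\<^sub>m M) \<cdot>\<^sub>v x"
    using ex_resolvent_line[OF V A' M x] by blast
  obtain w0 where w0: "w0 \<in> carrier_vec n"
    and resw: "\<And>s. map_vec (\<lambda>p. poly p s) w0 = A' *\<^sub>v map_vec (\<lambda>p. poly p s) w0
      + s \<cdot>\<^sub>v (M *\<^sub>v map_vec (\<lambda>p. poly p s) w0) + det (1\<^sub>m n - A' - s \<cdot>\<^sub>m M) \<cdot>\<^sub>v e"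
    using ex_resolvent_line[OF V A' M e] by blast
  define v where "v s = map_vec (\<lambda>p. poly p s) v0" for s
  define w where "w s = map_vec (\<lambda>p. poly p s) w0" for s
  have vc: "v s \<in> carrier_vec n" and wc: "w s \<in> carrier_vec n" for s
    using v0 w0 by (auto simp: v_def w_def)
  have d0: "d s \<noteq> 0" for s using D by (simp add: d_def)
  have v: "v s = A' *\<^sub>v v s + s \<cdot>\<^sub>v (M *\<^sub>v v s) + d s \<cdot>\<^sub>v x" for s using resv unfolding v_def d_def by simp
  have w: "w s = A' *\<^sub>v w s + s \<cdot>\<^sub>v (M *\<^sub>v w s) + d s \<cdot>\<^sub>v e" for s using resw unfolding w_def d_def by simp
  have c: "A' *\<^sub>v X \<in> carrier_vec n" "M *\<^sub>v X \<in> carrier_vec n" if "X \<in> carrier_vec n" for X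
    using A'c Mc that by auto
  have yv: "y \<bullet> v s = s * (y \<bullet> (M *\<^sub>v v s))" for s
    by (subst (1) v) (use y x c[OF vc] yA'[OF vc] yx in \<open>simp add: scalar_prod_add_distrib[of _ n]\<close>)
  have yw: "y \<bullet> w s = s * (y \<bullet> (M *\<^sub>v w s))" for s
    by (subst (1) w) (use y e c[OF wc] yA'[OF wc] ye in \<open>simp add: scalar_prod_add_distrib[of _ n]\<close>)
  have tr_det: "l \<bullet> w s = - (y \<bullet> v s)" "(y \<bullet> v s) * (l \<bullet> w s) = (y \<bullet> w s) * (l \<bullet> v s)" for s
  proof -
    \<comment> \<open>An eigenvector (a, b) for the eigenvalue 1 / t yields the vector X = a v + b
      w, which is fixed by A' + sM + d t A. So X is zero, and its recursion then contradicts the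
      independence of x and e.\<close>
    have no: False if ab: "a \<noteq> 0 \<or> b \<noteq> 0" and 1: "t * ((y \<bullet> v s) * a + (y \<bullet> w s) * b) = a"
      and 2: "t * ((l \<bullet> v s) * a + (l \<bullet> w s) * b) = b" for t a b
    proof -
      define X where "X = a \<cdot>\<^sub>v v s + b \<cdot>\<^sub>v w s"
      have X: "X \<in> carrier_vec n" using vc wc by (simp add: X_def)
      define B where "B = A' + s \<cdot>\<^sub>m M"
      have Bc: "B \<in> carrier_mat n n" using A'c Mc by (simp add: B_def)
      have B: "B *\<^sub>v Y = A' *\<^sub>v Y + s \<cdot>\<^sub>v (M *\<^sub>v Y)" if "Y \<in> carrier_vec n" for Y
        unfolding B_def using add_mult_distrib_mat_vec[OF A'c smult_carrier_mat[OF Mc] that]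
          smult_mat_mult_vec[OF Mc that] by simp
      have Bcv: "B *\<^sub>v v s \<in> carrier_vec n" "B *\<^sub>v w s \<in> carrier_vec n" using Bc vc wc by auto
      have BX: "B *\<^sub>v X = a \<cdot>\<^sub>v (B *\<^sub>v v s) + b \<cdot>\<^sub>v (B *\<^sub>v w s)"
        unfolding X_def using Bc vc wc by (simp add: mult_add_distrib_mat_vec[of _ n n] mult_mat_vec[of _ n n])
      have v': "v s = B *\<^sub>v v s + d s \<cdot>\<^sub>v x" using v[of s] B[OF vc] by simp
      have w': "w s = B *\<^sub>v w s + d s \<cdot>\<^sub>v e" using w[of s] B[OF wc] by simp
      have Xe: "X = B *\<^sub>v X + d s \<cdot>\<^sub>v (a \<cdot>\<^sub>v x + b \<cdot>\<^sub>v e)"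
      proof (rule eq_vecI)
        fix k assume "k < dim_vec (B *\<^sub>v X + d s \<cdot>\<^sub>v (a \<cdot>\<^sub>v x + b \<cdot>\<^sub>v e))"
        then have k: "k < n" using e by simp
        have "v s $ k = (B *\<^sub>v v s) $ k + d s * x $ k" "w s $ k = (B *\<^sub>v w s) $ k + d s * e $ k"
          using arg_cong[OF v', of "\<lambda>u. u $ k"] arg_cong[OF w', of "\<lambda>u. u $ k"] k x e Bc Bcv by (auto simp del: index_mult_mat_vec)
        then show "X $ k = (B *\<^sub>v X + d s \<cdot>\<^sub>v (a \<cdot>\<^sub>v x + b \<cdot>\<^sub>v e)) $ k"
          unfolding BX using k x e Bc Bcv vc[of s] wc[of s]
          by (simp add: X_def algebra_simps del: index_mult_mat_vec)
      qed (use X e in auto)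
      have yX: "y \<bullet> X = (y \<bullet> v s) * a + (y \<bullet> w s) * b" and lX: "l \<bullet> X = (l \<bullet> v s) * a + (l \<bullet> w s) * b"
        unfolding X_def using vc wc y l by (simp_all add: scalar_prod_add_distrib[of _ n])
      have tA: "(d s * t) \<cdot>\<^sub>v (A *\<^sub>v X) = d s \<cdot>\<^sub>v (a \<cdot>\<^sub>v x + b \<cdot>\<^sub>v e)"
      proof -
        have "(d s * t) \<cdot>\<^sub>v (A *\<^sub>v X) = d s \<cdot>\<^sub>v ((t * (y \<bullet> X)) \<cdot>\<^sub>v x + (t * (l \<bullet> X)) \<cdot>\<^sub>v e)"
          unfolding Axy[OF X] using x e by (intro eq_vecI) (auto simp: algebra_simps)
        then show ?thesis using 1 2 unfolding yX lX by simp
      qed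
      have "(B + (d s * t) \<cdot>\<^sub>m A) *\<^sub>v X = X"
        using add_mult_distrib_mat_vec[OF Bc smult_carrier_mat[OF Ac] X] smult_mat_mult_vec[OF Ac X] tA Xe by simp
      moreover have "B + (d s * t) \<cdot>\<^sub>m A \<in> V" unfolding B_def using V'(4,5) A A' M by blast
      ultimately have "X = 0\<^sub>v n" using V'(6) X by blast
      moreover have "B *\<^sub>v 0\<^sub>v n = 0\<^sub>v n" using Bc by (intro eq_vecI) auto
      ultimately have "0\<^sub>v n = d s \<cdot>\<^sub>v (a \<cdot>\<^sub>v x + b \<cdot>\<^sub>v e)" using Xe x e by simp
      then have "inverse (d s) \<cdot>\<^sub>v 0\<^sub>v n = inverse (d s) \<cdot>\<^sub>v (d s \<cdot>\<^sub>v (a \<cdot>\<^sub>v x + b \<cdot>\<^sub>v e))" by simp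
      moreover have "inverse (d s) \<cdot>\<^sub>v 0\<^sub>v n = 0\<^sub>v n" by (intro eq_vecI) auto
      ultimately have "a \<cdot>\<^sub>v x + b \<cdot>\<^sub>v e = 0\<^sub>v n" using d0 x e by (simp add: smult_smult_assoc)
      then show False using indep ab by blast
    qed
    show "l \<bullet> w s = - (y \<bullet> v s)" by (rule trace_det_2x2_zero(1)[OF qc]) (rule no)
    show "(y \<bullet> v s) * (l \<bullet> w s) = (y \<bullet> w s) * (l \<bullet> v s)"
      by (rule trace_det_2x2_zero(2)[OF qc]) (rule no)
  qed
  \<comment> \<open>Both y . v and y . w carry a factor s, because y vanishes on the image of A', on
    x and on e. Trace and determinant zero give (y . v)^2 + (y . w)(l . v) = 0, from which one
    factor s is cancelled.\<close>
  have main: "s * (y \<bullet> (M *\<^sub>v v s))\<^sup>2 + (y \<bullet> (M *\<^sub>v w s)) * (l \<bullet> v s) = 0" if "s \<noteq> 0" for s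
  proof -
    have "(y \<bullet> v s)\<^sup>2 + (y \<bullet> w s) * (l \<bullet> v s) = 0"
      unfolding tr_det(2)[symmetric] tr_det(1) by (simp add: power2_eq_square)
    then have "s * (s * (y \<bullet> (M *\<^sub>v v s))\<^sup>2 + (y \<bullet> (M *\<^sub>v w s)) * (l \<bullet> v s)) = 0"
      unfolding yv yw by (simp add: power2_eq_square algebra_simps)
    then show ?thesis using that by simp
  qed
  have transp: "y \<bullet> (M *\<^sub>v X) = (M\<^sup>T *\<^sub>v y) \<bullet> X" if "X \<in> carrier_vec n" for X
    using transpose_vec_mult_scalar[OF Mc that y] by simp
  have Mty: "M\<^sup>T *\<^sub>v y \<in> carrier_vec n" using Mc y by auto
  obtain p1 where p1: "\<And>s. poly p1 s = y \<bullet> (M *\<^sub>v v s)"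
    using functional_polynomial[OF Mty v0] transp[OF vc] v_def by metis
  obtain p2 where p2: "\<And>s. poly p2 s = y \<bullet> (M *\<^sub>v w s)"
    using functional_polynomial[OF Mty w0] transp[OF wc] w_def by metis
  obtain p3 where p3: "\<And>s. poly p3 s = l \<bullet> v s" using functional_polynomial[OF l v0] v_def by metis
  have "poly ([:0, 1:] * p1\<^sup>2 + p2 * p3) 0 = 0"
    by (rule poly_eq_0_at_0[OF inf]) (use main in \<open>simp add: p1 p2 p3\<close>)
  then have prod: "(y \<bullet> (M *\<^sub>v w 0)) * (l \<bullet> v 0) = 0" by (simp add: p2 p3)
  have uniq: "X = Y" if X: "X \<in> carrier_vec n" and Y: "Y \<in> carrier_vec n" and u: "u \<in> carrier_vec n"
    and "X = A' *\<^sub>v X + u" "Y = A' *\<^sub>v Y + u" for X Y u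
  proof -
    have "A' *\<^sub>v (X - Y) = A' *\<^sub>v X - A' *\<^sub>v Y" by (rule mult_minus_distrib_mat_vec[OF A'c X Y])
    also have "\<dots> = (A' *\<^sub>v X + u) - (A' *\<^sub>v Y + u)"
      using c(1)[OF X] c(1)[OF Y] u A'c by (intro eq_vecI) (auto simp del: index_mult_mat_vec)
    also have "\<dots> = X - Y" using that by simp
    finally have "X - Y = 0\<^sub>v n" using V'(6)[OF A'] X Y by simp
    then have "(X - Y) $ k = 0" if "k < n" for k using that by simp
    then show "X = Y" using X Y by (intro eq_vecI) auto
  qed
  \<comment> \<open>At s = 0 the resolvent vectors are explicit: e because A' e = 0, and z because
    it solves z = A' z + x.\<close>
  have w0': "w 0 = d 0 \<cdot>\<^sub>v e"
  proof (rule uniq[OF wc])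
    show "w 0 = A' *\<^sub>v w 0 + d 0 \<cdot>\<^sub>v e" using w[of 0] c[OF wc] e unfolding zero_smult_vec[OF c(2)[OF wc]] by simp
    have "d 0 \<cdot>\<^sub>v 0\<^sub>v n = 0\<^sub>v n" by (intro eq_vecI) auto
    then show "d 0 \<cdot>\<^sub>v e = A' *\<^sub>v (d 0 \<cdot>\<^sub>v e) + d 0 \<cdot>\<^sub>v e"
      using A'e e A'c by (simp add: mult_mat_vec[of _ n n])
  qed (use e in auto)
  have v0': "v 0 = d 0 \<cdot>\<^sub>v z"
  proof (rule uniq[OF vc])
    show "v 0 = A' *\<^sub>v v 0 + d 0 \<cdot>\<^sub>v x" using v[of 0] c[OF vc] x unfolding zero_smult_vec[OF c(2)[OF vc]] by simp
    have "A' *\<^sub>v (d 0 \<cdot>\<^sub>v z) + d 0 \<cdot>\<^sub>v x = d 0 \<cdot>\<^sub>v (A' *\<^sub>v z + x)"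
      using z x A'c c[OF z] by (simp add: mult_mat_vec[of _ n n] smult_add_distrib_vec[of _ n])
    then show "d 0 \<cdot>\<^sub>v z = A' *\<^sub>v (d 0 \<cdot>\<^sub>v z) + d 0 \<cdot>\<^sub>v x" using z_eq by simp
  qed (use x z in auto)
  have "y \<bullet> (M *\<^sub>v w 0) = d 0 * (y \<bullet> (M *\<^sub>v e))"
    unfolding w0' using Mc e y c[OF e] by (simp add: mult_mat_vec[of _ n n])
  moreover have "l \<bullet> v 0 = d 0 * (l \<bullet> z)" unfolding v0' using l z by simp
  ultimately show ?thesis using prod d0[of 0] yMe by simp
qed

section \<open>Existence of an invariant subspace\<close>

text \<open>Since the last column of A vanishes and its corner lives in column p, A equals x y^T + e
  l^T, with y and e the unit vectors at p and \<open>Suc p\<close> and l the last row of A.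
  \<open>rank_two_perturbation\<close> then makes l vanish on the resolvent z of x under A'. Varying
  A' produces enough vectors z to test l.\<close>

lemma corner_row_functional:
  fixes V :: "'a :: field mat set" and x :: "nat \<Rightarrow> 'a"
  assumes qc: "quadratically_closed TYPE('a)" and V: "trivial_spectrum_space (Suc (Suc p)) V"
    and A: "A \<in> ker_last (Suc p) V" and A': "A' \<in> ker_last (Suc p) V"
    and Acor: "\<And>a b. a < Suc p \<Longrightarrow> b < Suc p \<Longrightarrow> A $$ (a, b) = (if a < p \<and> b = p then x a else 0)"
    and x: "k < p" "x k \<noteq> 0"
    and A'row: "\<And>b. b < Suc p \<Longrightarrow> A' $$ (p, b) = 0"
    and M: "M \<in> V" "M $$ (p, Suc p) \<noteq> 0"
    and z: "z \<in> carrier_vec (Suc (Suc p))"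
    and z_eq: "A' *\<^sub>v z + vec (Suc (Suc p)) (\<lambda>a. if a < p then x a else 0) = z"
  shows "(\<Sum>b = 0..<Suc p. A $$ (Suc p, b) * z $ b) = 0"
proof -
  let ?n = "Suc (Suc p)"
  note V' = trivial_spectrum_spaceD[OF V]
  have AV: "A \<in> V" and A'V: "A' \<in> V" using A A' by (auto simp: ker_last_def)
  have Ac: "A \<in> carrier_mat ?n ?n" and A'c: "A' \<in> carrier_mat ?n ?n" and Mc: "M \<in> carrier_mat ?n ?n"
    using V'(2) AV A'V M by blast+
  have col: "A $$ (i, Suc p) = 0" "A' $$ (i, Suc p) = 0" if "i < ?n" for i
    using ker_last_col[OF V A that] ker_last_col[OF V A' that] by auto
  define xv where "xv = vec ?n (\<lambda>a. if a < p then x a else 0)"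
  define l where "l = vec ?n (\<lambda>b. A $$ (Suc p, b))"
  let ?y = "unit_vec ?n p :: 'a vec" and ?e = "unit_vec ?n (Suc p) :: 'a vec"
  have lX: "l \<bullet> X = (\<Sum>b = 0..<Suc p. A $$ (Suc p, b) * X $ b)" if "X \<in> carrier_vec ?n" for X
    using that col by (simp add: l_def scalar_prod_def)
  have "l \<bullet> z = 0"
  proof (rule rank_two_perturbation[OF qc V AV A'V M(1), of xv ?y ?e l z])
    fix X :: "'a vec" assume X: "X \<in> carrier_vec ?n"
    show "A *\<^sub>v X = (?y \<bullet> X) \<cdot>\<^sub>v xv + (l \<bullet> X) \<cdot>\<^sub>v ?e"
    proof (rule eq_vecI)
      fix i assume "i < dim_vec ((?y \<bullet> X) \<cdot>\<^sub>v xv + (l \<bullet> X) \<cdot>\<^sub>v ?e)"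
      then have i: "i < ?n" by simp
      have e: "(A *\<^sub>v X) $ i = (\<Sum>b = 0..<Suc p. A $$ (i, b) * X $ b)"
        using mult_mat_vec_index[OF Ac X i] col[OF i] by simp
      have yX: "?y \<bullet> X = X $ p" using X by simp
      show "(A *\<^sub>v X) $ i = ((?y \<bullet> X) \<cdot>\<^sub>v xv + (l \<bullet> X) \<cdot>\<^sub>v ?e) $ i"
      proof (cases "i = Suc p")
        case True
        then show ?thesis unfolding e using lX[OF X] i by (simp add: xv_def)
      next
        case False
        with i have i': "i < Suc p" by simp
        have "(\<Sum>b = 0..<Suc p. A $$ (i, b) * X $ b) = A $$ (i, p) * X $ p"
          using Acor[OF i'] by simp
        then show ?thesis unfolding e yX using Acor[OF i', of p] i False by (simp add: xv_def)
      qed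
    qed (use Ac in auto)
    have "(A' *\<^sub>v X) $ p = 0"
      using mult_mat_vec_index[OF A'c X, of p] A'row col(2)[of p] by simp
    then show "?y \<bullet> (A' *\<^sub>v X) = 0" using mult_mat_vec_carrier[OF A'c X] by simp
  next
    fix a b assume "a \<cdot>\<^sub>v xv + b \<cdot>\<^sub>v ?e = 0\<^sub>v ?n"
    then have "(a \<cdot>\<^sub>v xv + b \<cdot>\<^sub>v ?e) $ k = 0" "(a \<cdot>\<^sub>v xv + b \<cdot>\<^sub>v ?e) $ Suc p = 0"
      using x(1) by simp_all
    then show "a = 0 \<and> b = 0" using x by (simp add: xv_def)
  next
    show "A' *\<^sub>v ?e = 0\<^sub>v ?n" using A'c col(2) by (intro eq_vecI) auto
    show "?y \<bullet> (M *\<^sub>v ?e) \<noteq> 0" using Mc M(2) by simp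
    show "A' *\<^sub>v z + xv = z" using z_eq by (simp add: xv_def)
  qed (use z in \<open>auto simp: xv_def l_def\<close>)
  then show ?thesis using lX[OF z] by simp
qed

text \<open>Only the corner of the lift is prescribed. Its last row is unknown, which is the
  difficulty that \<open>corner_lift_rank_one\<close> resolves for matrix units in the last
  column.\<close>

lemma ex_lift_elementary:
  fixes V :: "'a :: field mat set"
  assumes V: "trivial_spectrum_space (Suc m) V"
    and lift: "strict_upper_triangular_mats m \<subseteq> block 0 0 m m ` ker_last m V"
    and ij: "i < j" "j < m"
  shows "\<exists>A\<in>ker_last m V. \<forall>a<m. \<forall>b<m. A $$ (a, b) = (if a = i \<and> b = j then 1 else 0)"
proof -
  let ?N = "mat m m (\<lambda>(a, b). if a = i \<and> b = j then 1 else 0) :: 'a mat"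
  have "?N \<in> strict_upper_triangular_mats m" using ij by (auto simp: strict_upper_triangular_mats_def)
  then obtain A where A: "A \<in> ker_last m V" "?N = block 0 0 m m A" using lift by blast
  have "A $$ (a, b) = (if a = i \<and> b = j then 1 else 0)" if "a < m" "b < m" for a b
  proof -
    have "block 0 0 m m A $$ (a, b) = ?N $$ (a, b)" using A by simp
    then show ?thesis using that by simp
  qed
  then show ?thesis using A by blast
qed

text \<open>The last row of the lift \<open>A i\<close> is tested on e_i, then on e_i + e_k for k <
  i, and finally that of \<open>A i + A k\<close> on e_i + e_k. Together these leave only its entry
  in column p, so \<open>A i\<close> has rank one and its kernel does not depend on i.\<close>

lemma corner_lift_rank_one:
  fixes V :: "'a :: field mat set"
  assumes qc: "quadratically_closed TYPE('a)" and V: "trivial_spectrum_space (Suc (Suc p)) V"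
    and lift: "strict_upper_triangular_mats (Suc p) \<subseteq> block 0 0 (Suc p) (Suc p) ` ker_last (Suc p) V"
    and M: "M \<in> V" "M $$ (p, Suc p) \<noteq> 0"
  shows "\<exists>A. \<forall>i<p. A i \<in> ker_last (Suc p) V \<and>
    (\<forall>a<Suc p. \<forall>b<Suc p. A i $$ (a, b) = (if a = i \<and> b = p then 1 else 0)) \<and>
    (\<forall>k<p. A i $$ (Suc p, k) = 0)"
proof -
  let ?n = "Suc (Suc p)"
  note V' = trivial_spectrum_spaceD[OF V]
  have "\<forall>i. \<exists>A. i < p \<longrightarrow> A \<in> ker_last (Suc p) V \<and>
    (\<forall>a<Suc p. \<forall>b<Suc p. A $$ (a, b) = (if a = i \<and> b = p then 1 else 0))"
    using ex_lift_elementary[OF V lift _ lessI] by blast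
  then obtain A where "\<forall>i. i < p \<longrightarrow> A i \<in> ker_last (Suc p) V \<and>
    (\<forall>a<Suc p. \<forall>b<Suc p. A i $$ (a, b) = (if a = i \<and> b = p then 1 else 0))"
    by metis
  then have A: "\<And>i. i < p \<Longrightarrow> A i \<in> ker_last (Suc p) V"
    and Ae: "\<And>i a b. i < p \<Longrightarrow> a < Suc p \<Longrightarrow> b < Suc p \<Longrightarrow> A i $$ (a, b) = (if a = i \<and> b = p then 1 else 0)"
    by blast+
  have U: "mat_subspace ?n ?n (ker_last (Suc p) V)"
    unfolding ker_last_def by (rule mat_dim_block(2)[OF V'(1)]) auto
  note U' = mat_subspaceD[OF U]
  have carr: "A i \<in> carrier_mat ?n ?n" if "i < p" for i using U'(1) A that by blast
  \<comment> \<open>Here A' = 0, so the resolvent of e_i is e_i itself.\<close>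
  have diag: "A i $$ (Suc p, i) = 0" if i: "i < p" for i
  proof -
    have "(\<Sum>b = 0..<Suc p. A i $$ (Suc p, b) * unit_vec ?n i $ b) = 0"
      by (rule corner_row_functional[OF qc V A[OF i] U'(2), of "\<lambda>a. if a = i then 1 else 0" i M])
        (use i M Ae zero_mult_mat_vec[of "unit_vec ?n i :: 'a vec" ?n ?n] in \<open>auto intro!: eq_vecI\<close>)
    then show ?thesis using i by (simp add: sum.delta if_distrib cong: if_cong)
  qed
  have lower: "A i $$ (Suc p, k) = 0" if k: "k < i" and i: "i < p" for i k
  proof -
    obtain B where B: "B \<in> ker_last (Suc p) V"
      and Be: "\<And>a b. a < Suc p \<Longrightarrow> b < Suc p \<Longrightarrow> B $$ (a, b) = (if a = k \<and> b = i then 1 else 0)"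
      using ex_lift_elementary[OF V lift k] i by auto
    have Bc: "B \<in> carrier_mat ?n ?n" using U'(1) B by blast
    have Bcol: "B $$ (a, Suc p) = 0" if "a < ?n" for a using ker_last_col[OF V B that] .
    \<comment> \<open>B lifts the matrix unit at (k, i), so the resolvent of e_i under B is e_i +
      e_k plus a multiple of the last basis vector: B e_i contributes its last entry, and B B e_i
      adds that of B e_k. The last coordinate is invisible to the last row of
      \<open>A i\<close>.\<close>
    define z where "z = vec ?n (\<lambda>a. if a = i \<or> a = k then 1 else if a = Suc p then B $$ (Suc p, i) + B $$ (Suc p, k) else 0)"
    have z: "z \<in> carrier_vec ?n" by (simp add: z_def)
    have sum: "(\<Sum>b = 0..<Suc p. f b * z $ b) = f i + f k" for f :: "nat \<Rightarrow> 'a"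
    proof -
      have "(\<Sum>b = 0..<Suc p. f b * z $ b) = (\<Sum>b \<in> {i, k}. f b * z $ b)"
        by (rule sum.mono_neutral_right) (use i k in \<open>auto simp: z_def\<close>)
      then show ?thesis using i k by (simp add: z_def)
    qed
    have "(\<Sum>b = 0..<Suc p. A i $$ (Suc p, b) * z $ b) = 0"
    proof (rule corner_row_functional[OF qc V A[OF i] B, of "\<lambda>a. if a = i then 1 else 0" i M])
      show "B *\<^sub>v z + vec ?n (\<lambda>a. if a < p then if a = i then 1 else 0 else 0) = z"
      proof (rule eq_vecI)
        fix a assume "a < dim_vec z"
        then have a: "a < ?n" by (simp add: z_def)
        have "(B *\<^sub>v z) $ a = B $$ (a, i) + B $$ (a, k)"
          using mult_mat_vec_index[OF Bc z a] Bcol[OF a] sum[of "\<lambda>b. B $$ (a, b)"] by simp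
        then show "(B *\<^sub>v z + vec ?n (\<lambda>a. if a < p then if a = i then 1 else 0 else 0)) $ a = z $ a"
          using a i k Be[of a i] Be[of a k] Bc by (cases "a = Suc p") (auto simp: z_def simp del: index_mult_mat_vec)
      qed (use Bc in \<open>simp add: z_def\<close>)
    qed (use i k M Ae Be z in auto)
    then show ?thesis using sum[of "\<lambda>b. A i $$ (Suc p, b)"] diag[OF i] by simp
  qed
  \<comment> \<open>No matrix unit at (i, k) with k < i is available in the strictly upper
    triangular corner. Instead the sum \<open>A i + A k\<close> is tested with A' = 0; three of the
    four resulting entries are already known to vanish.\<close>
  have upper: "A k $$ (Suc p, i) = 0" if k: "k < i" and i: "i < p" for i k
  proof -
    have k': "k < p" using k i by simp
    define z :: "'a vec" where "z = vec ?n (\<lambda>a. if a = i \<or> a = k then 1 else 0)"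
    have z: "z \<in> carrier_vec ?n" by (simp add: z_def)
    have sum: "(\<Sum>b = 0..<Suc p. f b * z $ b) = f i + f k" for f :: "nat \<Rightarrow> 'a"
    proof -
      have "(\<Sum>b = 0..<Suc p. f b * z $ b) = (\<Sum>b \<in> {i, k}. f b * z $ b)"
        by (rule sum.mono_neutral_right) (use i k in \<open>auto simp: z_def\<close>)
      then show ?thesis using i k by (simp add: z_def)
    qed
    have "(\<Sum>b = 0..<Suc p. (A i + A k) $$ (Suc p, b) * z $ b) = 0"
    proof (rule corner_row_functional[OF qc V U'(3)[OF A[OF i] A[OF k']] U'(2), of "\<lambda>a. if a = i \<or> a = k then 1 else 0" i M])
      show "0\<^sub>m ?n ?n *\<^sub>v z + vec ?n (\<lambda>a. if a < p then if a = i \<or> a = k then 1 else 0 else 0) = z"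
        unfolding zero_mult_mat_vec[OF z] using i k by (auto simp: z_def)
      fix a b assume "a < Suc p" "b < Suc p"
      then show "(A i + A k) $$ (a, b) = (if a < p \<and> b = p then if a = i \<or> a = k then 1 else 0 else 0)"
        using carr[OF i] carr[OF k'] Ae[OF i, of a b] Ae[OF k', of a b] i k by auto
    qed (use i k M z in auto)
    then have "(A i + A k) $$ (Suc p, i) + (A i + A k) $$ (Suc p, k) = 0" unfolding sum .
    then show ?thesis
      using carr[OF i] carr[OF k'] i k' diag[OF i] diag[OF k'] lower[OF k i] by simp
  qed
  have "A i $$ (Suc p, k) = 0" if "i < p" "k < p" for i k
    using diag lower upper that by (cases i k rule: linorder_cases) auto
  then show ?thesis using A Ae by blast
qed

text \<open>The invariant subspace is spanned by the images x_i of the rank one lifts, x_i being e_i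
  plus \<open>lam i\<close> times the last basis vector. It is cut out by X_p = 0 and f X = 0. The
  two conclusions of \<open>rank_one_perturbation\<close>, on M x_i and M M x_i, supply these two
  equations for M x_i.\<close>

lemma ex_invariant_subspace:
  fixes V :: "'a :: field mat set"
  assumes qc: "quadratically_closed TYPE('a)" and V: "trivial_spectrum_space (Suc (Suc p)) V"
    and lift: "strict_upper_triangular_mats (Suc p) \<subseteq> block 0 0 (Suc p) (Suc p) ` ker_last (Suc p) V"
    and M0: "M0 \<in> V" "M0 $$ (p, Suc p) \<noteq> 0"
  shows "\<exists>P Q. inverse_pair (p + 2) P Q \<and> (\<forall>M\<in>V. block p 0 2 p (Q * M * P) = 0\<^sub>m 2 p)"
proof -
  let ?n = "Suc (Suc p)"
  note V' = trivial_spectrum_spaceD[OF V]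
  obtain A where A': "\<forall>i<p. A i \<in> ker_last (Suc p) V \<and>
    (\<forall>a<Suc p. \<forall>b<Suc p. A i $$ (a, b) = (if a = i \<and> b = p then 1 else 0)) \<and>
    (\<forall>k<p. A i $$ (Suc p, k) = 0)"
    using corner_lift_rank_one[OF qc V lift M0] ..
  have A: "A i \<in> ker_last (Suc p) V"
    and Ae: "\<And>a b. a < Suc p \<Longrightarrow> b < Suc p \<Longrightarrow> A i $$ (a, b) = (if a = i \<and> b = p then 1 else 0)"
    and Al: "\<And>k. k < p \<Longrightarrow> A i $$ (Suc p, k) = 0" if "i < p" for i
    using A'[rule_format, OF that] by blast+
  define lam where "lam i = A i $$ (Suc p, p)" for i
  define x where "x i = vec ?n (\<lambda>a. if a = i then 1 else if a = Suc p then lam i else 0)" for i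
  have xc: "x i \<in> carrier_vec ?n" for i by (simp add: x_def)
  have AV: "A i \<in> V" if "i < p" for i using A[OF that] by (simp add: ker_last_def)
  have rank1: "A i *\<^sub>v X = (unit_vec ?n p \<bullet> X) \<cdot>\<^sub>v x i" if i: "i < p" and X: "X \<in> carrier_vec ?n" for i X
  proof (rule eq_vecI)
    fix a assume "a < dim_vec ((unit_vec ?n p \<bullet> X) \<cdot>\<^sub>v x i)"
    then have a: "a < ?n" by (simp add: x_def)
    have Ac: "A i \<in> carrier_mat ?n ?n" using V'(2)[OF AV[OF i]] .
    have "(A i *\<^sub>v X) $ a = (\<Sum>b = 0..<p. A i $$ (a, b) * X $ b) + A i $$ (a, p) * X $ p"
      using mult_mat_vec_index[OF Ac X a] ker_last_col[OF V A[OF i] a] by simp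
    also have "(\<Sum>b = 0..<p. A i $$ (a, b) * X $ b) = 0"
    proof (rule sum.neutral, rule ballI)
      fix b assume "b \<in> {0..<p}"
      then have "A i $$ (a, b) = 0"
        using a i Ae[OF i, of a b] Al[OF i, of b] by (cases "a = Suc p") auto
      then show "A i $$ (a, b) * X $ b = 0" by simp
    qed
    also have "A i $$ (a, p) = x i $ a"
      using a i Ae[OF i, of a p] by (cases "a = Suc p") (auto simp: x_def lam_def)
    finally show "(A i *\<^sub>v X) $ a = ((unit_vec ?n p \<bullet> X) \<cdot>\<^sub>v x i) $ a"
      using a X by (simp add: x_def)
  qed (use V'(2)[OF AV[OF i]] in \<open>simp add: x_def\<close>)
  note inf = quadratically_closed_infinite[OF qc]
  have R: "(M *\<^sub>v x i) $ p = 0" "(M *\<^sub>v (M *\<^sub>v x i)) $ p = 0" if i: "i < p" and M: "M \<in> V" for M i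
  proof -
    have Mc: "M \<in> carrier_mat ?n ?n" using V'(2)[OF M] .
    have c: "M *\<^sub>v x i \<in> carrier_vec ?n" "M *\<^sub>v (M *\<^sub>v x i) \<in> carrier_vec ?n" using Mc xc by auto
    show "(M *\<^sub>v x i) $ p = 0" "(M *\<^sub>v (M *\<^sub>v x i)) $ p = 0"
      using rank_one_perturbation[OF inf V AV[OF i] M xc _ rank1[OF i]] c by auto
  qed
  \<comment> \<open>The equation (M x_i)_p = 0 determines row p of M up to a scalar: on vectors with
    X_p = 0 it equals M(p, n - 1) times f, where n - 1 is the last index.\<close>
  have row: "M $$ (p, i) = - lam i * M $$ (p, Suc p)" if i: "i < p" and M: "M \<in> V" for M i
  proof -
    have "(M *\<^sub>v x i) $ p = (\<Sum>b = 0..<Suc p. M $$ (p, b) * x i $ b) + M $$ (p, Suc p) * lam i"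
      using mult_mat_vec_index[OF V'(2)[OF M] xc, of p i] i by (simp add: x_def)
    also have "(\<Sum>b = 0..<Suc p. M $$ (p, b) * x i $ b) = (\<Sum>b = 0..<Suc p. if b = i then M $$ (p, b) else 0)"
      by (rule sum.cong) (auto simp: x_def)
    also have "\<dots> = M $$ (p, i)" using i by simp
    finally show ?thesis using R(1)[OF i M] by (simp add: eq_neg_iff_add_eq_0 mult.commute)
  qed
  define f where "f X = X $ Suc p - (\<Sum>b = 0..<p. lam b * X $ b)" for X
  have fM: "M $$ (p, Suc p) * f (M *\<^sub>v x i) = 0" if i: "i < p" and M: "M \<in> V" for M i
  proof -
    let ?X = "M *\<^sub>v x i"
    have X: "?X \<in> carrier_vec ?n" using V'(2)[OF M] xc by auto
    have "(M *\<^sub>v ?X) $ p = (\<Sum>b = 0..<p. M $$ (p, b) * ?X $ b) + M $$ (p, Suc p) * ?X $ Suc p"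
      using mult_mat_vec_index[OF V'(2)[OF M] X, of p] R(1)[OF i M] by simp
    also have "(\<Sum>b = 0..<p. M $$ (p, b) * ?X $ b) = - M $$ (p, Suc p) * (\<Sum>b = 0..<p. lam b * ?X $ b)"
      unfolding sum_distrib_left by (rule sum.cong) (auto simp: row[OF _ M] algebra_simps)
    finally show ?thesis using R(2)[OF i M] by (auto simp: f_def algebra_simps)
  qed
  \<comment> \<open>When the factor M(p, n - 1) vanishes it cannot be cancelled. Adding
    \<open>M0\<close>, whose factor is non-zero, restores it, and f is linear.\<close>
  have f0: "f (M *\<^sub>v x i) = 0" if i: "i < p" and M: "M \<in> V" for M i
  proof (cases "M $$ (p, Suc p) = 0")
    case True
    have Mc: "M \<in> carrier_mat ?n ?n" "M0 \<in> carrier_mat ?n ?n" using V'(2) M M0 by blast+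
    have c: "M *\<^sub>v x i \<in> carrier_vec ?n" "M0 *\<^sub>v x i \<in> carrier_vec ?n" using Mc xc by auto
    have "(M + M0) $$ (p, Suc p) \<noteq> 0" using True M0(2) Mc by simp
    then have "f ((M + M0) *\<^sub>v x i) = 0" using fM[OF i V'(4)[OF M M0(1)]] by simp
    moreover have "f ((M + M0) *\<^sub>v x i) = f (M *\<^sub>v x i) + f (M0 *\<^sub>v x i)"
      unfolding add_mult_distrib_mat_vec[OF Mc xc] f_def using Mc c i
      by (simp add: sum.distrib algebra_simps del: index_mult_mat_vec)
    moreover have "f (M0 *\<^sub>v x i) = 0" using fM[OF i M0(1)] M0(2) by simp
    ultimately show ?thesis by simp
  qed (use fM[OF i M] in simp)
  \<comment> \<open>The first p columns of \<open>L 1\<close> are the vectors x_i, and the last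
    coordinate of \<open>L (- 1)\<close> applied to X is f X. In this basis invariance reads as a
    zero lower left block.\<close>
  define L where "L t = mat ?n ?n (\<lambda>(a, b). if a = b then 1 else if a = Suc p \<and> b < p then t * lam b else 0)" for t
  have Lc: "L t \<in> carrier_mat ?n ?n" for t by (simp add: L_def)
  have Lmult: "L t *\<^sub>v X = vec ?n (\<lambda>a. if a = Suc p then X $ Suc p + t * (\<Sum>b = 0..<p. lam b * X $ b) else X $ a)"
    if X: "X \<in> carrier_vec ?n" for t X
  proof (rule eq_vecI)
    fix a assume "a < dim_vec (vec ?n (\<lambda>a. if a = Suc p then X $ Suc p + t * (\<Sum>b = 0..<p. lam b * X $ b) else X $ a))"
    then have a: "a < ?n" by simp
    show "(L t *\<^sub>v X) $ a = vec ?n (\<lambda>a. if a = Suc p then X $ Suc p + t * (\<Sum>b = 0..<p. lam b * X $ b) else X $ a) $ a"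
    proof (cases "a = Suc p")
      case True
      have "(L t *\<^sub>v X) $ a = (\<Sum>b = 0..<p. L t $$ (Suc p, b) * X $ b) + L t $$ (Suc p, p) * X $ p + L t $$ (Suc p, Suc p) * X $ Suc p"
        using mult_mat_vec_index[OF Lc X a, of t] True by simp
      also have "(\<Sum>b = 0..<p. L t $$ (Suc p, b) * X $ b) = t * (\<Sum>b = 0..<p. lam b * X $ b)"
        unfolding sum_distrib_left by (rule sum.cong) (auto simp: L_def)
      finally show ?thesis using True by (simp add: L_def)
    next
      case False
      have "(L t *\<^sub>v X) $ a = (\<Sum>b = 0..<?n. if b = a then X $ a else 0)"
        unfolding mult_mat_vec_index[OF Lc X a] by (rule sum.cong) (use False a in \<open>auto simp: L_def\<close>)
      then show ?thesis using a False by simp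
    qed
  qed (simp add: L_def)
  have LL: "L t * L (- t) = 1\<^sub>m ?n" for t
  proof (rule eq_matI)
    fix a b assume ab: "a < dim_row (1\<^sub>m ?n :: 'a mat)" "b < dim_col (1\<^sub>m ?n :: 'a mat)"
    have cc: "col (L (- t)) b \<in> carrier_vec ?n" using Lc[of "-t"] ab by auto
    have "(L t * L (- t)) $$ (a, b) = (L t *\<^sub>v col (L (- t)) b) $ a"
      using ab Lc[of t] Lc[of "- t"] by simp
    also have "\<dots> = 1\<^sub>m ?n $$ (a, b)"
    proof -
      have "(\<Sum>c = 0..<p. lam c * col (L (- t)) b $ c) = (\<Sum>c = 0..<p. if c = b then lam b else 0)"
        by (rule sum.cong) (use ab in \<open>auto simp: L_def\<close>)
      then show ?thesis unfolding Lmult[OF cc] using ab by (auto simp: L_def)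
    qed
    finally show "(L t * L (- t)) $$ (a, b) = 1\<^sub>m ?n $$ (a, b)" .
  qed (use Lc in auto)
  have pair: "inverse_pair (p + 2) (L 1) (L (- 1))"
    using LL[of 1] LL[of "-1"] Lc by (simp add: inverse_pair_def)
  have "block p 0 2 p (L (- 1) * M * L 1) = 0\<^sub>m 2 p" if M: "M \<in> V" for M
  proof (rule eq_matI)
    fix a i assume "a < dim_row (0\<^sub>m 2 p :: 'a mat)" "i < dim_col (0\<^sub>m 2 p :: 'a mat)"
    then have a: "a < 2" and i: "i < p" by auto
    have Mc: "M \<in> carrier_mat ?n ?n" using V'(2)[OF M] .
    have ci: "col (L 1) i = x i" using i by (auto simp: L_def x_def)
    have X: "M *\<^sub>v x i \<in> carrier_vec ?n" using Mc xc by auto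
    define B where "B = L (- 1) * M"
    have Bc: "B \<in> carrier_mat ?n ?n" unfolding B_def by (rule mult_carrier_mat[OF Lc Mc])
    have "(B * L 1) $$ (p + a, i) = (B *\<^sub>v x i) $ (p + a)"
      using a i Lc[of 1] Bc by (simp add: ci[symmetric])
    also have "B *\<^sub>v x i = L (- 1) * M *\<^sub>v x i" by (simp add: B_def)
    also have "L (- 1) * M *\<^sub>v x i = L (- 1) *\<^sub>v (M *\<^sub>v x i)"
      by (rule assoc_mult_mat_vec[OF Lc Mc xc])
    also have "\<dots> $ (p + a) = 0"
      unfolding Lmult[OF X] using a R(1)[OF i M] f0[OF i M]
      by (cases "a = 0") (auto simp: f_def less_2_cases_iff)
    finally show "block p 0 2 p (L (- 1) * M * L 1) $$ (a, i) = 0\<^sub>m 2 p $$ (a, i)"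
      using a i by (simp add: B_def del: index_mult_mat(1))
  qed auto
  then show ?thesis using pair by blast
qed

section \<open>Triangularization\<close>

lemma strict_upper_subspace:
  "mat_subspace n n (strict_upper_triangular_mats n :: 'a :: field mat set)"
  by (auto simp: mat_subspace_def strict_upper_triangular_mats_def)

text \<open>At the largest index where X is non-zero, N X only involves later coordinates of X,
  which are all zero.\<close>

lemma strict_upper_trivial_spectrum_space:
  "trivial_spectrum_space n (strict_upper_triangular_mats n :: 'a :: field mat set)"
  unfolding trivial_spectrum_space_def
proof (rule conjI[OF strict_upper_subspace])
  show "trivial_spectrum n (strict_upper_triangular_mats n :: 'a mat set)"
    unfolding trivial_spectrum_def
  proof (rule ballI, rule notI, elim bexE conjE)
    fix N X assume N: "N \<in> (strict_upper_triangular_mats n :: 'a mat set)"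
      and X: "X \<in> carrier_vec n" "X \<noteq> 0\<^sub>v n" "N *\<^sub>v X = X"
    define I where "I = {i. i < n \<and> X $ i \<noteq> 0}"
    have fin: "finite I" by (simp add: I_def)
    have "I \<noteq> {}"
    proof
      assume "I = {}"
      then have "X = 0\<^sub>v n" using X(1) by (intro eq_vecI) (auto simp: I_def)
      with X show False by simp
    qed
    then have m: "Max I \<in> I" using fin by simp
    then have mn: "Max I < n" by (simp add: I_def)
    have "X $ Max I = (\<Sum>j = 0..<n. N $$ (Max I, j) * X $ j)"
      using mult_mat_vec_index[of N n n X "Max I"] N X mn by (simp add: strict_upper_triangular_mats_def)
    also have "\<dots> = 0"
    proof (rule sum.neutral, rule ballI)
      fix j assume "j \<in> {0..<n}"
      then have j: "j < n" by simp
      show "N $$ (Max I, j) * X $ j = 0"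
      proof (cases "j \<le> Max I")
        case True
        then show ?thesis using N j mn by (simp add: strict_upper_triangular_mats_def)
      next
        case False
        then have "j \<notin> I" using fin Max_ge by blast
        then show ?thesis using j by (simp add: I_def)
      qed
    qed
    finally show False using m by (simp add: I_def)
  qed
qed

text \<open>The corner decomposition used for the upper bound is sharp here: NT is adapted, its last
  column is arbitrary, and its corner is NT of one size less.\<close>

lemma mat_dim_strict_upper:
  "mat_dim n n (strict_upper_triangular_mats n :: 'a :: field mat set) = n choose 2"
proof (induction n)
  case 0
  then show ?case using mat_dim_le[OF strict_upper_subspace[of 0]] by (simp add: binomial_eq_0)
next
  case (Suc m)
  let ?N = "strict_upper_triangular_mats (Suc m) :: 'a mat set"
  note ts = strict_upper_trivial_spectrum_space[of "Suc m", where ?'a = 'a]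
  have ad: "adapted_last m ?N"
    unfolding adapted_last_def
  proof (intro ballI impI)
    fix M assume M: "M \<in> ?N" and z: "\<forall>k<m. \<forall>j<Suc m. M $$ (k, j) = 0"
    show "M = 0\<^sub>m (Suc m) (Suc m)"
    proof (rule eq_matI)
      fix i j assume "i < dim_row (0\<^sub>m (Suc m) (Suc m) :: 'a mat)" "j < dim_col (0\<^sub>m (Suc m) (Suc m) :: 'a mat)"
      then show "M $$ (i, j) = 0\<^sub>m (Suc m) (Suc m) $$ (i, j)"
        using M z by (cases "i = m") (auto simp: strict_upper_triangular_mats_def)
    qed (use M in \<open>auto simp: strict_upper_triangular_mats_def\<close>)
  qed
  have "block 0 m m 1 ` ?N = carrier_mat m 1"
  proof (rule equalityI)
    show "carrier_mat m 1 \<subseteq> block 0 m m 1 ` ?N"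
    proof
      fix C :: "'a mat" assume C: "C \<in> carrier_mat m 1"
      let ?M = "mat (Suc m) (Suc m) (\<lambda>(i, j). if i < m \<and> j = m then C $$ (i, 0) else 0)"
      have "C = block 0 m m 1 ?M" using C by (intro eq_matI) auto
      moreover have "?M \<in> ?N" by (auto simp: strict_upper_triangular_mats_def)
      ultimately show "C \<in> block 0 m m 1 ` ?N" by blast
    qed
  qed auto
  moreover have "block 0 0 m m ` ker_last m ?N = strict_upper_triangular_mats m"
  proof (rule equalityI)
    show "block 0 0 m m ` ker_last m ?N \<subseteq> strict_upper_triangular_mats m"
      by (auto simp: ker_last_def strict_upper_triangular_mats_def)
    show "strict_upper_triangular_mats m \<subseteq> block 0 0 m m ` ker_last m ?N"
    proof
      fix K :: "'a mat" assume K: "K \<in> strict_upper_triangular_mats m"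
      let ?M = "mat (Suc m) (Suc m) (\<lambda>(i, j). if i < m \<and> j < m then K $$ (i, j) else 0)"
      have "K = block 0 0 m m ?M" using K by (intro eq_matI) (auto simp: strict_upper_triangular_mats_def)
      moreover have "?M \<in> ker_last m ?N"
        using K by (auto simp: ker_last_def strict_upper_triangular_mats_def intro!: eq_matI)
      ultimately show "K \<in> block 0 0 m m ` ker_last m ?N" by blast
    qed
  qed
  ultimately show ?case
    using corner_space(3)[OF ts ad] Suc.IH mat_dim_carrier[of m 1, where ?'a = 'a] by (simp add: choose_2_Suc)
qed

lemma triangularizable_full:
  fixes V :: "'a :: field mat set"
  assumes V: "mat_subspace n n V" "mat_dim n n V = n choose 2"
    and PQ: "inverse_pair n P Q" and t: "\<forall>M\<in>V. Q * M * P \<in> strict_upper_triangular_mats n"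
  shows "(\<lambda>M. Q * M * P) ` V = strict_upper_triangular_mats n"
  by (rule mat_dim_mono(2)[OF mat_dim_conj(1)[OF PQ V(1)] strict_upper_subspace])
    (use t V(2) mat_dim_conj(2)[OF PQ V(1)] mat_dim_strict_upper[of n, where ?'a = 'a] in auto)

lemma block_four_block_mat:
  assumes "A \<in> carrier_mat p p" "B \<in> carrier_mat p q" "D \<in> carrier_mat q q"
  shows "block 0 0 p p (four_block_mat A B C D) = A" "block 0 p p q (four_block_mat A B C D) = B"
  using assms by (auto intro!: eq_matI)

text \<open>The hypothesis \<open>ad\<close> makes V the line through \<open>M0\<close>. Trace and
  determinant zero give \<open>M0\<close> the rows (k, 1) and (- k^2, - k), so it is
  nilpotent.\<close>

lemma triangularizable_2:
  fixes V :: "'a :: field mat set"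
  assumes qc: "quadratically_closed TYPE('a)" and V: "trivial_spectrum_space 2 V"
    and M0: "M0 \<in> V" "M0 $$ (0, 1) = 1"
    and ad: "\<And>M. M \<in> V \<Longrightarrow> M $$ (0, 1) = 0 \<Longrightarrow> M = 0\<^sub>m 2 2"
  shows "triangularizable 2 V"
proof -
  note V' = trivial_spectrum_spaceD[OF V]
  define k where "k = M0 $$ (0, 0)"
  have Mc: "M0 \<in> carrier_mat 2 2" using V'(2)[OF M0(1)] .
  have no: False if "a \<noteq> 0 \<or> b \<noteq> 0" and 1: "t * (k * a + 1 * b) = a"
    and 2: "t * (M0 $$ (1, 0) * a + M0 $$ (1, 1) * b) = b" for t a b
  proof -
    define X where "X = vec 2 (\<lambda>i. if i = 0 then a else b)"
    have X: "X \<in> carrier_vec 2" by (simp add: X_def)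
    have "(t \<cdot>\<^sub>m M0) *\<^sub>v X = X"
    proof (rule eq_vecI)
      fix i assume "i < dim_vec X"
      then have i: "i < 2" by (simp add: X_def)
      then have "((t \<cdot>\<^sub>m M0) *\<^sub>v X) $ i = t * (M0 $$ (i, 0) * a + M0 $$ (i, 1) * b)"
        using mult_mat_vec_index[of "t \<cdot>\<^sub>m M0" 2 2 X i] Mc X
        by (simp add: X_def numeral_2_eq_2 algebra_simps)
      then show "((t \<cdot>\<^sub>m M0) *\<^sub>v X) $ i = X $ i"
        using i 1 2 M0(2) by (auto simp: less_2_cases_iff X_def k_def)
    qed (use Mc in \<open>simp add: X_def\<close>)
    then have "X = 0\<^sub>v 2" using V'(6)[OF V'(5)[OF M0(1)] X] by blast
    then have "X $ 0 = 0" "X $ 1 = 0" by simp_all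
    then show False using that(1) by (simp add: X_def)
  qed
  have tr: "M0 $$ (1, 1) = - k" by (rule trace_det_2x2_zero(1)[OF qc]) (rule no)
  have "k * M0 $$ (1, 1) = 1 * M0 $$ (1, 0)" by (rule trace_det_2x2_zero(2)[OF qc]) (rule no)
  then have det: "M0 $$ (1, 0) = - k * k" using tr by simp
  \<comment> \<open>The kernel of \<open>M0\<close> is spanned by (1, - k), the first column of
    \<open>L (- k)\<close>.\<close>
  define L :: "'a \<Rightarrow> 'a mat" where "L t = mat 2 2 (\<lambda>(i, j). if i = j then 1 else if i = 1 then t else 0)" for t
  have Lc: "L t \<in> carrier_mat 2 2" for t by (simp add: L_def)
  have "L t * L (- t) = 1\<^sub>m 2" for t
    by (rule eq_matI) (auto simp: L_def scalar_prod_def numeral_2_eq_2 less_Suc_eq)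
  from this[of k] this[of "- k"] have pair: "inverse_pair 2 (L (- k)) (L k)"
    using Lc by (simp add: inverse_pair_def)
  have "L k * M * L (- k) \<in> strict_upper_triangular_mats 2" if M: "M \<in> V" for M
  proof -
    have Mc': "M \<in> carrier_mat 2 2" using V'(2)[OF M] .
    have "M + (- M $$ (0, 1)) \<cdot>\<^sub>m M0 = 0\<^sub>m 2 2"
      by (rule ad[OF V'(4)[OF M V'(5)[OF M0(1)]]]) (use Mc Mc' M0(2) in simp)
    then have h: "(M + (- M $$ (0, 1)) \<cdot>\<^sub>m M0) $$ (i, j) = 0" if "i < 2" "j < 2" for i j using that by simp
    have e: "M $$ (i, j) = M $$ (0, 1) * M0 $$ (i, j)" if "i < 2" "j < 2" for i j
    proof -
      have "M $$ (i, j) - M $$ (0, 1) * M0 $$ (i, j) = 0" using h[OF that] that Mc Mc' by simp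
      then show ?thesis by simp
    qed
    define c where "c = M $$ (0, 1)"
    have e': "M $$ (0, 0) = c * k" "M $$ (0, Suc 0) = c" "M $$ (Suc 0, 0) = - (c * k * k)" "M $$ (Suc 0, Suc 0) = - (c * k)"
      using e[of 0 0] e[of 1 0] e[of 1 1] tr det by (simp_all add: c_def k_def)
    show ?thesis
      unfolding strict_upper_triangular_mats_def using Lc[of k] Lc[of "- k"] Mc'
      by (auto simp: scalar_prod_def numeral_2_eq_2 less_Suc_eq L_def e' algebra_simps)
  qed
  then show ?thesis using pair unfolding triangularizable_def by blast
qed

theorem maximal_trivial_spectrum_triangularizable:
  fixes V :: "'a :: field mat set"
  assumes qc: "quadratically_closed TYPE('a)" and V: "trivial_spectrum_space n V"
    and d: "mat_dim n n V = n choose 2"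
  shows "triangularizable n V"
  using V d
proof (induction n arbitrary: V rule: less_induct)
  case (less n V)
  note V' = trivial_spectrum_spaceD[OF less.prems(1)]
  show ?case
  proof (cases n)
    case 0
    then have "inverse_pair n (1\<^sub>m n) (1\<^sub>m n :: 'a mat)" by (simp add: inverse_pair_def)
    moreover have "1\<^sub>m n * M * 1\<^sub>m n \<in> strict_upper_triangular_mats n" if "M \<in> V" for M
      using V'(2)[OF that] 0 by (auto simp: strict_upper_triangular_mats_def)
    ultimately show ?thesis unfolding triangularizable_def by blast
  next
    case (Suc m)
    obtain P0 Q0 where pq0: "inverse_pair (Suc m) P0 Q0" and ad: "adapted_last m ((\<lambda>M. Q0 * M * P0) ` V)"
      using ex_adapted_last[of m V] less.prems(1) Suc by blast
    define V1 where "V1 = (\<lambda>M. Q0 * M * P0) ` V"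
    have V1: "trivial_spectrum_space (Suc m) V1"
      unfolding V1_def using trivial_spectrum_space_conj[OF pq0] less.prems(1) Suc by simp
    have d1: "mat_dim (Suc m) (Suc m) V1 = Suc m choose 2"
      unfolding V1_def using mat_dim_conj(2)[OF pq0] V'(1) less.prems(2) Suc by simp
    have back1: "triangularizable (Suc m) V1 \<Longrightarrow> triangularizable n V"
      using triangularizable_conjD[OF pq0, of V] V'(2) Suc unfolding V1_def by blast
    have ad1: "adapted_last m V1" using ad by (simp add: V1_def)
    note V1' = trivial_spectrum_spaceD[OF V1]
    note surj = maximal_corner_space(1)[OF V1 ad1 d1]
    define W where "W = block 0 0 m m ` ker_last m V1"
    have W: "trivial_spectrum_space m W" "mat_dim m m W = m choose 2"
      using corner_space(2)[OF V1 ad1] maximal_corner_space(2)[OF V1 ad1 d1] by (simp_all add: W_def)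
    have "triangularizable m W" using less.IH[of m W] W Suc by simp
    then obtain P1 Q1 where pq1: "inverse_pair m P1 Q1"
      and t: "\<forall>M\<in>W. Q1 * M * P1 \<in> strict_upper_triangular_mats m"
      unfolding triangularizable_def by blast
    note full = triangularizable_full[OF trivial_spectrum_spaceD(1)[OF W(1)] W(2) pq1 t]
    \<comment> \<open>Size 2 is separate: in the splitting n = p + 2 the lower block would be the
      whole matrix and the induction would not descend.\<close>
    consider "m = 0" | "m = 1" | p where "m = Suc p" "p > 0" by (metis One_nat_def not0_implies_Suc not_gr_zero)
    then show ?thesis
    proof cases
      case 1
      have "V = {0\<^sub>m n n}"
        using mat_dim_eq_0_iff[OF V'(1)] less.prems(2) Suc 1 by simp
      moreover have "inverse_pair n (1\<^sub>m n) (1\<^sub>m n :: 'a mat)" by (simp add: inverse_pair_def)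
      moreover have "1\<^sub>m n * 0\<^sub>m n n * 1\<^sub>m n \<in> (strict_upper_triangular_mats n :: 'a mat set)"
        by (simp add: strict_upper_triangular_mats_def)
      ultimately show ?thesis unfolding triangularizable_def by blast
    next
      case 2
      have two: "Suc m = 2" using 2 by simp
      obtain M0 where M0: "M0 \<in> V1" "block 0 m m 1 M0 = mat m 1 (\<lambda>_. 1)"
        using surj by (metis imageE mat_carrier)
      have "block 0 m m 1 M0 $$ (0, 0) = 1" using M0 2 by simp
      then have M01: "M0 $$ (0, 1) = 1" using 2 by simp
      have W0: "W = {0\<^sub>m m m}" using mat_dim_eq_0_iff[OF trivial_spectrum_spaceD(1)[OF W(1)]] W(2) 2 by simp
      \<comment> \<open>Such an M lies in \<open>ker_last\<close>, and its corner is zero because W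
        has dimension 0. Its first row vanishes, and adaptedness does the rest.\<close>
      have ad2: "M = 0\<^sub>m 2 2" if M: "M \<in> V1" and z: "M $$ (0, 1) = 0" for M
      proof -
        have k: "M \<in> ker_last m V1" using M z 2 by (auto simp: ker_last_def intro!: eq_matI)
        then have "block 0 0 m m M = 0\<^sub>m m m" using W0 unfolding W_def by blast
        then have "block 0 0 m m M $$ (0, 0) = 0" using 2 by simp
        then have "M $$ (0, 0) = 0" using 2 by simp
        then have "\<forall>k<m. \<forall>j<Suc m. M $$ (k, j) = 0" using z 2 by (auto simp: less_Suc_eq)
        then show ?thesis using ad1 M two unfolding adapted_last_def by auto
      qed
      have "triangularizable (Suc m) V1"
        unfolding two by (rule triangularizable_2[OF qc _ M0(1) M01 ad2]) (use V1 two in auto)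
      then show ?thesis by (rule back1)
    next
      case (3 p)
      \<comment> \<open>The basis change acts on the first m coordinates only, so the condition
        defining \<open>ker_last\<close> survives it and the corner becomes all of NT_m.\<close>
      let ?P = "four_block_mat P1 (0\<^sub>m m 1) (0\<^sub>m 1 m) (1\<^sub>m 1)" and ?Q = "four_block_mat Q1 (0\<^sub>m m 1) (0\<^sub>m 1 m) (1\<^sub>m 1)"
      have one: "inverse_pair 1 (1\<^sub>m 1) (1\<^sub>m 1 :: 'a mat)" by (simp add: inverse_pair_def)
      have pq2: "inverse_pair (Suc m) ?P ?Q" using inverse_pair_diag[OF pq1 one] by simp
      define V2 where "V2 = (\<lambda>M. ?Q * M * ?P) ` V1"
      have V2: "trivial_spectrum_space (Suc m) V2"
        unfolding V2_def by (rule trivial_spectrum_space_conj[OF pq2 V1])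
      have d2: "mat_dim (Suc m) (Suc m) V2 = Suc m choose 2"
        unfolding V2_def using mat_dim_conj(2)[OF pq2 V1'(1)] d1 by simp
      have back2: "triangularizable (Suc m) V2 \<Longrightarrow> triangularizable (Suc m) V1"
        using triangularizable_conjD[OF pq2, of V1] V1'(2) unfolding V2_def by blast
      note V2' = trivial_spectrum_spaceD[OF V2]
      note pqc = inverse_pairD[OF pq1]
      have blocks: "block 0 0 m m (?Q * M * ?P) = Q1 * block 0 0 m m M * P1"
        "block 0 m m 1 (?Q * M * ?P) = Q1 * block 0 m m 1 M" if M: "M \<in> V1" for M
      proof -
        have Mc: "M \<in> carrier_mat (m + 1) (m + 1)" using V1'(2)[OF M] by simp
        have c: "Q1 * block 0 0 m m M * P1 \<in> carrier_mat m m" "Q1 * block 0 m m 1 M \<in> carrier_mat m 1"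
          "block m m 1 1 M \<in> carrier_mat 1 1"
          using mult_carrier_mat[OF mult_carrier_mat[OF pqc(2) block_carrier] pqc(1)]
            mult_carrier_mat[OF pqc(2) block_carrier] by auto
        have e: "?Q * M * ?P = four_block_mat (Q1 * block 0 0 m m M * P1) (Q1 * block 0 m m 1 M)
            (1\<^sub>m 1 * block m 0 1 m M * P1) (1\<^sub>m 1 * block m m 1 1 M * 1\<^sub>m 1)"
          using conj_diag_blocks[OF pq1 one Mc] right_mult_one_mat[OF c(2)] by simp
        have c4: "1\<^sub>m 1 * block m m 1 1 M * 1\<^sub>m 1 \<in> carrier_mat 1 1" by auto
        show "block 0 0 m m (?Q * M * ?P) = Q1 * block 0 0 m m M * P1"
          unfolding e by (rule block_four_block_mat(1)[OF c(1,2) c4])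
        show "block 0 m m 1 (?Q * M * ?P) = Q1 * block 0 m m 1 M"
          unfolding e by (rule block_four_block_mat(2)[OF c(1,2) c4])
      qed
      have lift: "strict_upper_triangular_mats m \<subseteq> block 0 0 m m ` ker_last m V2"
      proof
        fix N :: "'a mat" assume "N \<in> strict_upper_triangular_mats m"
        then obtain M where M: "M \<in> ker_last m V1" "N = Q1 * block 0 0 m m M * P1"
          unfolding full[symmetric] W_def by blast
        have MV: "M \<in> V1" and z: "block 0 m m 1 M = 0\<^sub>m m 1" using M by (auto simp: ker_last_def)
        have "block 0 m m 1 (?Q * M * ?P) = 0\<^sub>m m 1"
          unfolding blocks(2)[OF MV] z using pqc by simp
        then have "?Q * M * ?P \<in> ker_last m V2" using MV by (simp add: ker_last_def V2_def)
        moreover have "N = block 0 0 m m (?Q * M * ?P)" using blocks(1)[OF MV] M by simp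
        ultimately show "N \<in> block 0 0 m m ` ker_last m V2" by blast
      qed
      \<comment> \<open>The factor \<open>P1\<close> cancels the \<open>Q1\<close> that conjugation
        puts in front of the last column. Of the resulting column of ones only the entry at p is
        used.\<close>
      obtain M1 where M1: "M1 \<in> V1" "block 0 m m 1 M1 = P1 * mat m 1 (\<lambda>_. 1)"
        using surj pqc(1) by (metis imageE mat_carrier mult_carrier_mat)
      define M0 where "M0 = ?Q * M1 * ?P"
      have M0V: "M0 \<in> V2" using M1 by (simp add: M0_def V2_def)
      have "block 0 m m 1 M0 = Q1 * (P1 * mat m 1 (\<lambda>_. 1))"
        unfolding M0_def blocks(2)[OF M1(1)] M1(2) ..
      also have "\<dots> = (Q1 * P1) * mat m 1 (\<lambda>_. 1)"
        by (rule assoc_mult_mat[symmetric, OF pqc(2,1) mat_carrier])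
      also have "\<dots> = mat m 1 (\<lambda>_. 1)" unfolding pqc(4) by (rule left_mult_one_mat[OF mat_carrier])
      finally have "block 0 m m 1 M0 $$ (p, 0) = 1" using 3 by simp
      then have M0p: "M0 $$ (p, Suc p) \<noteq> 0" using 3 by simp
      obtain P3 Q3 where pq3: "inverse_pair (p + 2) P3 Q3"
        and inv: "\<forall>M\<in>V2. block p 0 2 p (Q3 * M * P3) = 0\<^sub>m 2 p"
        using ex_invariant_subspace[OF qc _ _ M0V M0p] V2 lift unfolding 3 by blast
      define V3 where "V3 = (\<lambda>M. Q3 * M * P3) ` V2"
      have n2: "Suc m = p + 2" using 3 by simp
      have V3: "trivial_spectrum_space (p + 2) V3"
        unfolding V3_def using trivial_spectrum_space_conj[OF pq3] V2 n2 by simp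
      have d3: "mat_dim (p + 2) (p + 2) V3 = (p + 2) choose 2"
        unfolding V3_def using mat_dim_conj(2)[OF pq3] V2'(1) d2 unfolding n2 by simp
      have tri: "block p 0 2 p M = 0\<^sub>m 2 p" if "M \<in> V3" for M using that inv by (auto simp: V3_def)
      note bs = block_triangular_spaces[OF V3 d3 tri]
      have "triangularizable p (block 0 0 p p ` V3)" using less.IH[OF _ bs(1,3)] Suc 3 by simp
      \<comment> \<open>Here p > 0 matters: it makes 2 smaller than p + 2.\<close>
      moreover have "triangularizable 2 (block p p 2 2 ` V3)" using less.IH[OF _ bs(2,4)] Suc 3 by simp
      ultimately have "triangularizable (p + 2) V3"
        using triangularizable_block[of V3 p 2] tri trivial_spectrum_spaceD(2)[OF V3] by blast
      then have "triangularizable (p + 2) V2"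
        using triangularizable_conjD[OF pq3, of V2] V2'(2) unfolding V3_def n2 by blast
      then show ?thesis using back1 back2 unfolding n2 by blast
    qed
  qed
qed

theorem corollary5:
  fixes n :: nat
  assumes "quadratically_closed TYPE('a :: field)"
  shows "maximal_trivial_spectrum_subspace n (strict_upper_triangular_mats n :: 'a mat set) \<and>
    (\<forall>V :: 'a mat set. maximal_trivial_spectrum_subspace n V \<longrightarrow>
      (\<exists>R \<in> Units (ring_mat TYPE('a) n ()).
        V = (\<lambda>N. R * N * inv\<^bsub>ring_mat TYPE('a) n ()\<^esub> R) ` strict_upper_triangular_mats n))"
proof (intro conjI allI impI)
  show "maximal_trivial_spectrum_subspace n (strict_upper_triangular_mats n :: 'a mat set)"
    unfolding maximal_trivial_spectrum_subspace_iff
    using strict_upper_trivial_spectrum_space mat_dim_strict_upper by blast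
  fix V :: "'a mat set" assume "maximal_trivial_spectrum_subspace n V"
  then have V: "trivial_spectrum_space n V" "mat_dim n n V = n choose 2"
    unfolding maximal_trivial_spectrum_subspace_iff by blast+
  note V' = trivial_spectrum_spaceD[OF V(1)]
  obtain P Q where pq: "inverse_pair n P Q" and t: "\<forall>M\<in>V. Q * M * P \<in> strict_upper_triangular_mats n"
    using maximal_trivial_spectrum_triangularizable[OF assms V] unfolding triangularizable_def by blast
  note pq' = inverse_pairD[OF pq]
  have full: "(\<lambda>M. Q * M * P) ` V = strict_upper_triangular_mats n"
    by (rule triangularizable_full[OF V'(1) V(2) pq t])
  let ?R = "ring_mat TYPE('a) n ()"
  interpret R: ring ?R by (rule ring_mat)
  have inv: "inv\<^bsub>?R\<^esub> P = Q"
    by (rule R.inv_unique'[symmetric]) (use pq' in \<open>simp_all add: ring_mat_simps\<close>)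
  have "P \<in> Units ?R" unfolding Units_def using pq' by (auto simp: ring_mat_simps)
  \<comment> \<open>Undoing the conjugation in the equality \<open>full\<close> exhibits P as the
    required R.\<close>
  moreover have "V = (\<lambda>N. P * N * Q) ` strict_upper_triangular_mats n"
    unfolding full[symmetric] image_image using inverse_pair_conj[OF pq V'(2)] by simp
  ultimately show "\<exists>R\<in>Units ?R. V = (\<lambda>N. R * N * inv\<^bsub>?R\<^esub> R) ` strict_upper_triangular_mats n"
    using inv by (intro bexI[of _ P]) simp_all
qed

end
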